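(* Let $X$ be a topological space. Then the topology $\mathcal{T}_A$ on $X^{-1}$, the topology $\mathcal{T}_G|_{X^{-1}}$ induced on $X^{-1}$ by the Graev topology $\mathcal{T}_G$ on $F_a(X)$, and the topology $\mathcal{T}_F|_{X^{-1}}$ induced on $X^{-1}$ by the free topology $\mathcal{T}_F$ on $F_a(X)$ are equal.
   Context: $F_a(X)$ is the abstract free group on the set $X$, with identity $e$, and $X^{-1}=\{x^{-1}:x\in X\}\subseteq F_a(X)$. The topology $\mathcal{T}_A$: the topology on $X^{-1}$ having as a base the collection $\{A^{-1}: A \text{ closed in } X\}$, where $A^{-1}=\{a^{-1}:a\in A\}$; equivalently, having $\{(\mathrm{cl}_X\{x\})^{-1}:x\in X\}$ as a base. The free topology: a paratopological group is a group $G$ with a topology such that multiplication $G\times G\to G$ is continuous. The (Markov) free paratopological group $\mathit{FP}(X)$ is a paratopological group that contains $X$ as a topological subspace, is generated algebraically by $X$, and is such that every continuous map $f:X\to H$ into an arbitrary paratopological group $H$ extends to a continuous homomorphism $\hat f:\mathit{FP}(X)\to H$. It exists for every space $X$, and its underlying abstract group is $F_a(X)$; $\mathcal{T}_F$ denotes its topology. The Graev topology: a quasi-pseudometric on a set $Y$ is a function $d:Y\times Y\to[0,\infty)$ with $d(x,x)=0$ and $d(x,y)\le d(x,z)+d(z,y)$ for all $x,y,z\in Y$. Let $d$ be a quasi-pseudometric on $X$ bounded by $1$. Extend $d$ to $d_e$ on $X\cup\{e\}$ by $d_e(x,y)=0$ if $x=y$, $d_e(x,y)=d(x,y)$ if $x,y\in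 X$, and $d_e(x,y)=1$ otherwise. Extend $d_e$ to $d^*$ on $\tilde X=X\cup\{e\}\cup X^{-1}$ by $d^*(x,y)=0$ if $x=y$, $d^*(x,y)=d_e(x,y)$ if $x,y\in X\cup\{e\}$, $d^*(x,y)=d_e(y^{-1},x^{-1})$ if $x,y\in X^{-1}\cup\{e\}$, and $d^*(x,y)=2$ otherwise. A scheme on $\{1,\ldots,2n\}$ ($n\ge1$) is a bijection $\varphi$ of this set onto itself such that $\varphi(i)\ne i$ and $\varphi(\varphi(i))=i$ for all $i$, and there are no $i,j$ with $i<j<\varphi(i)<\varphi(j)$. For a word $\mathcal{X}=x_1\ldots x_{2n}$ over the alphabet $\tilde X$, let $[\mathcal{X}]\in F_a(X)$ be the element (reduced word) it represents, and for a scheme $\varphi$ on $\{1,\ldots,2n\}$ put $\Gamma_d(\mathcal{X},\varphi)=\frac12\sum_{i=1}^{2n}d^*(x_i^{-1},x_{\varphi(i)})$. Define $N_d(e)=0$ and, for $g\in F_a(X)$ with $g\ne e$, $N_d(g)=\inf\Gamma_d(\mathcal{X},\varphi)$, the infimum being over all $n\in\mathbb{N}$, all words $\mathcal{X}$ over $\tilde X$ of length $2n$ with $[\mathcal{X}]=g$, and all schemes $\varphi$ on $\{1,\ldots,2n\}$. The Graev extension of $d$ is $\hat d(g,h)=N_d(g^{-1}h)$ for $g,h\in F_a(X)$; it is a quasi-pseudometric on $F_a(X)$ invariant under left and right translations. Let $\mathcal{T}_d$ be the paratopological group topology on $F_a(X)$ for which the balls $\{g:\hat d(e,g)<\varepsilon\}$,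 $\varepsilon>0$, form a base at $e$. Let $\mathcal{D}_1$ be the family of all quasi-pseudometrics $d$ on $X$ that are bounded by $1$ and such that for every $x\in X$ the function $y\mapsto d(x,y)$ is upper semi-continuous on $X$ (equivalently, all balls $\{y:d(x,y)<\varepsilon\}$, $\varepsilon>0$, are open in $X$). The Graev topology $\mathcal{T}_G$ on $F_a(X)$ is the supremum of the topologies $\mathcal{T}_d$, $d\in\mathcal{D}_1$. *)

theory Defs
  imports "HOL-Analysis.Analysis" "HOL-Algebra.Generated_Groups"
begin

section \<open>The abstract free group on a set\<close>

text \<open>The letter \<open>(x, True)\<close> stands for \<open>x\<close> and \<open>(x, False)\<close> for its formal inverse. Elements of the
  free group are reduced_word words.\<close>

type_synonym 'a word = "('a \<times> bool) list"

definition flip :: "'a \<times> bool \<Rightarrow> 'a \<times> bool" where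
  "flip a = (fst a, \<not> snd a)"

definition reduced_word :: "'a word \<Rightarrow> bool" where
  "reduced_word w \<longleftrightarrow> successively (\<lambda>a b. b \<noteq> flip a) w"

fun cancel_cons :: "'a \<times> bool \<Rightarrow> 'a word \<Rightarrow> 'a word" where
  "cancel_cons a [] = [a]"
| "cancel_cons a (b # w) = (if b = flip a then w else a # b # w)"

definition reduce :: "'a word \<Rightarrow> 'a word" where
  "reduce w = foldr cancel_cons w []"

definition free_group :: "'a set \<Rightarrow> 'a word monoid" where
  "free_group S = \<lparr>carrier = {w. reduced_word w \<and> fst ` set w \<subseteq> S},
                   monoid.mult = (\<lambda>u v. reduce (u @ v)), one = []\<rparr>"

definition gen :: "'a \<Rightarrow> 'a word" where
  "gen x = [(x, True)]"

text \<open>\<open>inverses S A\<close> is the set \<open>A\<^sup>-\<^sup>1\<close>, formed in the free group on \<open>S\<close>.\<close>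

definition inverses :: "'a set \<Rightarrow> 'a set \<Rightarrow> 'a word set" where
  "inverses S A = (\<lambda>x. inv\<^bsub>free_group S\<^esub> (gen x)) ` A"

lemma flip_flip [simp]: "flip (flip a) = a"
  by (simp add: flip_def)

lemma fst_flip [simp]: "fst (flip a) = fst a"
  by (simp add: flip_def)

lemma flip_neq [simp]: "flip a \<noteq> a" "a \<noteq> flip a"
  by (auto simp: flip_def prod_eq_iff)

lemma reduced_Nil [simp]: "reduced_word []" and reduced_single [simp]: "reduced_word [a]"
  and reduced_Cons2 [simp]: "reduced_word (a # b # w) \<longleftrightarrow> b \<noteq> flip a \<and> reduced_word (b # w)"
  by (auto simp: reduced_word_def)

lemma reduced_ConsD: "reduced_word (a # w) \<Longrightarrow> reduced_word w"
  by (cases w) auto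

lemma reduced_cancel_cons: "reduced_word w \<Longrightarrow> reduced_word (cancel_cons a w)"
  by (cases w) (auto dest: reduced_ConsD)

lemma cancel_cons_flip: "reduced_word w \<Longrightarrow> cancel_cons a (cancel_cons (flip a) w) = w"
proof (cases w)
  case (Cons b v)
  assume "reduced_word w"
  with Cons show ?thesis by (cases v) auto
qed simp

lemma set_cancel_cons: "set (cancel_cons a w) \<subseteq> insert a (set w)"
  by (cases w) auto

lemma reduced_foldr: "reduced_word z \<Longrightarrow> reduced_word (foldr cancel_cons u z)"
  by (induction u) (auto intro: reduced_cancel_cons)

lemma reduced_reduce [simp]: "reduced_word (reduce w)"
  by (simp add: reduce_def reduced_foldr)

lemma set_reduce: "set (reduce w) \<subseteq> set w"
  unfolding reduce_def
proof (induction w)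
  case (Cons a w)
  then show ?case using set_cancel_cons[of a "foldr cancel_cons w []"] by auto
qed simp

lemma reduce_id: "reduced_word w \<Longrightarrow> reduce w = w"
proof (induction w)
  case (Cons a w)
  then have "reduce w = w" by (blast dest: reduced_ConsD)
  then have "reduce (a # w) = cancel_cons a w" by (simp add: reduce_def)
  then show ?case using Cons.prems by (cases w) auto
qed (simp add: reduce_def)

lemma foldr_cancel_cons: 
  assumes "reduced_word z" 
  shows "foldr cancel_cons (cancel_cons a r) z = cancel_cons a (foldr cancel_cons r z)"
proof (cases r)
  case (Cons b w)
  show ?thesis
    using Cons cancel_cons_flip[OF reduced_foldr[OF assms], of a w] by auto
qed simp

lemma foldr_reduce: "reduced_word z \<Longrightarrow> foldr cancel_cons (reduce u) z = foldr cancel_cons u z"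
proof (induction u)
  case (Cons a u)
  have "reduce (a # u) = cancel_cons a (reduce u)" by (simp add: reduce_def)
  then show ?case using Cons by (simp add: foldr_cancel_cons)
qed (simp add: reduce_def)

lemma reduce_append: "reduce (u @ v) = foldr cancel_cons u (reduce v)"
  by (simp add: reduce_def)

lemma reduce_reduce [simp]: "reduce (reduce w) = reduce w"
  by (simp add: reduce_id)

lemma reduce_left: "reduce (reduce u @ v) = reduce (u @ v)"
  by (simp add: reduce_append foldr_reduce)

lemma reduce_right: "reduce (u @ reduce v) = reduce (u @ v)"
  by (simp add: reduce_append)

lemma reduce_inverse: "reduce (map flip (rev u) @ u) = []"
proof (induction u)
  case (Cons a u)
  have "reduce (flip a # a # u) = reduce u"
    using cancel_cons_flip[of "reduce u" "flip a"] by (simp add: reduce_def reduced_foldr)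
  then have "reduce (map flip (rev u) @ flip a # a # u) = reduce (map flip (rev u) @ u)"
    by (metis reduce_right)
  then show ?case using Cons by simp
qed (simp add: reduce_def)

lemma carrier_free_group: "carrier (free_group S) = {w. reduced_word w \<and> fst ` set w \<subseteq> S}"
  and mult_free_group: "u \<otimes>\<^bsub>free_group S\<^esub> v = reduce (u @ v)"
  and one_free_group [simp]: "\<one>\<^bsub>free_group S\<^esub> = []"
  by (auto simp: free_group_def)

lemma reduce_mem: "fst ` set w \<subseteq> S \<Longrightarrow> reduce w \<in> carrier (free_group S)"
  using set_reduce[of w] by (auto simp: carrier_free_group)

lemma group_free_group: "group (free_group S)"
proof (rule groupI)
  fix x assume x: "x \<in> carrier (free_group S)"
  have "reduce (map flip (rev x)) \<otimes>\<^bsub>free_group S\<^esub> x = \<one>\<^bsub>free_group S\<^esub>"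
    by (simp add: mult_free_group reduce_left reduce_inverse)
  moreover have "reduce (map flip (rev x)) \<in> carrier (free_group S)"
    using x by (intro reduce_mem) (auto simp: carrier_free_group image_image)
  ultimately show "\<exists>y\<in>carrier (free_group S). y \<otimes>\<^bsub>free_group S\<^esub> x = \<one>\<^bsub>free_group S\<^esub>" by blast
next
  fix x y assume "x \<in> carrier (free_group S)" "y \<in> carrier (free_group S)"
  then show "x \<otimes>\<^bsub>free_group S\<^esub> y \<in> carrier (free_group S)"
    unfolding mult_free_group by (intro reduce_mem) (auto simp: carrier_free_group)
qed (auto simp: mult_free_group reduce_left reduce_right reduce_id carrier_free_group)

lemma gen_mem: "x \<in> S \<Longrightarrow> gen x \<in> carrier (free_group S)"
  by (auto simp: gen_def carrier_free_group)

lemma inj_gen: "inj gen"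
  by (auto simp: inj_def gen_def)

lemma inv_gen: "x \<in> S \<Longrightarrow> inv\<^bsub>free_group S\<^esub> (gen x) = [(x, False)]"
  by (rule group.inv_equality[OF group_free_group])
    (auto simp: mult_free_group carrier_free_group gen_def reduce_def flip_def)

lemma generate_free_group: "generate (free_group S) (gen ` S) = carrier (free_group S)"
proof (intro subset_antisym subsetI)
  interpret group "free_group S" by (rule group_free_group)
  fix w assume "w \<in> generate (free_group S) (gen ` S)"
  then show "w \<in> carrier (free_group S)"
    by (rule generate_in_carrier[rotated]) (auto intro: gen_mem)
next
  fix w :: "'a word" assume "w \<in> carrier (free_group S)"
  then have "reduced_word w" "fst ` set w \<subseteq> S" by (auto simp: carrier_free_group)
  then show "w \<in> generate (free_group S) (gen ` S)"
  proof (induction w)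
    case Nil
    show ?case using generate.one[of "free_group S"] by simp
  next
    case (Cons a w)
    have w: "w \<in> generate (free_group S) (gen ` S)"
      using Cons by (auto dest: reduced_ConsD)
    have a: "[a] \<in> generate (free_group S) (gen ` S)"
    proof (cases "snd a")
      case True
      then have "[a] = gen (fst a)" by (simp add: gen_def prod_eq_iff)
      then show ?thesis using Cons.prems by (auto intro: generate.incl)
    next
      case False
      have x: "fst a \<in> S" using Cons.prems by simp
      have "[a] = inv\<^bsub>free_group S\<^esub> (gen (fst a))" 
        using False by (simp add: inv_gen[OF x] prod_eq_iff)
      then show ?thesis using generate.inv[of "gen (fst a)" "gen ` S" "free_group S"] x by simp
    qed
    have "a # w = [a] \<otimes>\<^bsub>free_group S\<^esub> w"
      using reduce_id[OF Cons.prems(1)] by (simp add: mult_free_group)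
    then show ?case using generate.eng[OF a w] by simp
  qed
qed

definition letter_value :: "('b, 'c) monoid_scheme \<Rightarrow> ('a \<Rightarrow> 'b) \<Rightarrow> 'a \<times> bool \<Rightarrow> 'b" where
  "letter_value H f a = (if snd a then f (fst a) else inv\<^bsub>H\<^esub> f (fst a))"

definition word_value :: "('b, 'c) monoid_scheme \<Rightarrow> ('a \<Rightarrow> 'b) \<Rightarrow> 'a word \<Rightarrow> 'b" where
  "word_value H f w = foldr (\<lambda>a h. letter_value H f a \<otimes>\<^bsub>H\<^esub> h) w \<one>\<^bsub>H\<^esub>"

lemma word_value_hom:
  assumes "group H" and f: "f \<in> S \<rightarrow> carrier H"
  shows "word_value H f \<in> hom (free_group S) H" 
    and "\<And>x. x \<in> S \<Longrightarrow> word_value H f (gen x) = f x"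
proof -
  interpret H: group H by fact
  let ?v = "word_value H f" and ?l = "letter_value H f"
  have l: "?l a \<in> carrier H" if "fst a \<in> S" for a
    using f that by (auto simp: letter_value_def)
  have lflip: "?l a \<otimes>\<^bsub>H\<^esub> ?l (flip a) = \<one>\<^bsub>H\<^esub>" if "fst a \<in> S" for a
    using f that by (auto simp: letter_value_def flip_def Pi_def)
  have Cons: "?v (a # w) = ?l a \<otimes>\<^bsub>H\<^esub> ?v w" for a w by (simp add: word_value_def)
  have v: "?v w \<in> carrier H" if "fst ` set w \<subseteq> S" for w
    using that by (induction w) (auto simp: Cons l, simp add: word_value_def)
  have cc: "?v (cancel_cons a w) = ?l a \<otimes>\<^bsub>H\<^esub> ?v w" if "fst a \<in> S" "fst ` set w \<subseteq> S" for a w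
  proof (cases w)
    case (Cons b u)
    show ?thesis
    proof (cases "b = flip a")
      case True
      have "?v w = ?l (flip a) \<otimes>\<^bsub>H\<^esub> ?v u" using True Cons \<open>\<And>w a. ?v (a # w) = _\<close> by simp
      moreover have "?v u \<in> carrier H" "?l a \<in> carrier H" "?l (flip a) \<in> carrier H"
        using that Cons l[of a] l[of "flip a"] by (auto intro: v)
      ultimately have "?l a \<otimes>\<^bsub>H\<^esub> ?v w = ?v u"
        using lflip[of a] that by (simp flip: H.m_assoc)
      then show ?thesis using True Cons by simp
    qed (use Cons \<open>\<And>w a. ?v (a # w) = _\<close> in simp)
  qed (simp add: Cons)
  have red: "?v (reduce w) = ?v w" if "fst ` set w \<subseteq> S" for w
    using that
  proof (induction w)
    case (Cons a w)
    have "fst ` set (reduce w) \<subseteq> S" using Cons.prems set_reduce[of w] by auto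
    then show ?case using Cons cc[of a "reduce w"] \<open>\<And>w a. ?v (a # w) = _\<close> 
      by (simp add: reduce_def)
  qed (simp add: reduce_def)
  have app: "?v (u @ w) = ?v u \<otimes>\<^bsub>H\<^esub> ?v w" if "fst ` set u \<subseteq> S" "fst ` set w \<subseteq> S" for u w
    using that(1)
  proof (induction u)
    case Nil
    show ?case using v[OF that(2)] by (simp add: word_value_def)
  next
    case (Cons a u)
    then show ?case using v[OF that(2)] v[of u] l[of a] \<open>\<And>w a. ?v (a # w) = _\<close>
      by (simp add: H.m_assoc)
  qed
  show "?v \<in> hom (free_group S) H"
    by (rule homI) (auto simp: carrier_free_group mult_free_group red app v image_Un)
  show "?v (gen x) = f x" if "x \<in> S" for x
    using f that by (auto simp: word_value_def gen_def letter_value_def Pi_def)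
qed


section \<open>The topology on the inverses of the generators\<close>

definition inverse_topology :: "'a topology \<Rightarrow> 'a word topology" where
  "inverse_topology X =
     topology (arbitrary union_of (\<lambda>B. \<exists>A. closedin X A \<and> B = inverses (topspace X) A))"

lemma inverses_eq: "A \<subseteq> S \<Longrightarrow> inverses S A = (\<lambda>x. [(x, False)]) ` A"
  unfolding inverses_def by (intro image_cong) (auto simp: inv_gen)

lemma openin_inverse_topology:
  "openin (inverse_topology X) =
     arbitrary union_of (\<lambda>B. \<exists>A. closedin X A \<and> B = inverses (topspace X) A)"
  unfolding inverse_topology_def
proof (rule topology_inverse', rule istopology_base, elim exE conjE)
  fix B B' A A' assume *: "closedin X A" "B = inverses (topspace X) A" 
    "closedin X A'" "B' = inverses (topspace X) A'"
  have "A \<subseteq> topspace X" "A' \<subseteq> topspace X" "A \<inter> A' \<subseteq> topspace X"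
    using *(1,3) by (auto dest: closedin_subset)
  note eqs = this[THEN inverses_eq]
  have "B \<inter> B' = inverses (topspace X) (A \<inter> A')"
    unfolding *(2,4) eqs by auto
  then show "\<exists>A. closedin X A \<and> B \<inter> B' = inverses (topspace X) A"
    using closedin_Int[OF *(1,3)] by blast
qed

lemma topspace_inverse_topology: "topspace (inverse_topology X) = inverses (topspace X) (topspace X)"
proof
  show "topspace (inverse_topology X) \<subseteq> inverses (topspace X) (topspace X)"
  proof
    fix w assume w: "w \<in> topspace (inverse_topology X)"
    have "(arbitrary union_of (\<lambda>B. \<exists>A. closedin X A \<and> B = inverses (topspace X) A))
        (topspace (inverse_topology X))"
      by (simp flip: openin_inverse_topology)
    then obtain \<U> where \<U>: "\<U> \<subseteq> {B. \<exists>A. closedin X A \<and> B = inverses (topspace X) A}"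
      "\<Union>\<U> = topspace (inverse_topology X)"
      unfolding union_of_def by auto
    obtain B where "B \<in> \<U>" "w \<in> B"
      using w unfolding \<U>(2)[symmetric] by (rule UnionE)
    then obtain A where "closedin X A" "w \<in> inverses (topspace X) A"
      using \<U>(1) by (auto dest!: subsetD)
    then show "w \<in> inverses (topspace X) (topspace X)"
      using closedin_subset[of X A] by (auto simp: inverses_def)
  qed
  have "openin (inverse_topology X) (inverses (topspace X) (topspace X))"
    unfolding openin_inverse_topology by (rule arbitrary_union_of_inc) blast
  then show "inverses (topspace X) (topspace X) \<subseteq> topspace (inverse_topology X)"
    by (rule openin_subset)
qed


section \<open>Paratopological groups and the free topology\<close>

definition paratopological_group :: "('b, 'c) monoid_scheme \<Rightarrow> 'b topology \<Rightarrow> bool" where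
  "paratopological_group G T \<longleftrightarrow> group G \<and> topspace T = carrier G \<and>
     continuous_map (prod_topology T T) T (\<lambda>(x, y). x \<otimes>\<^bsub>G\<^esub> y)"

definition extends_continuous_maps ::
    "'a topology \<Rightarrow> 'a word topology \<Rightarrow> ('b, 'c) monoid_scheme \<Rightarrow> 'b topology \<Rightarrow> bool" where
  "extends_continuous_maps X T H T\<^sub>H \<longleftrightarrow>
     (\<forall>f. continuous_map X T\<^sub>H f \<longrightarrow>
       (\<exists>h \<in> hom (free_group (topspace X)) H.
          continuous_map T T\<^sub>H h \<and> (\<forall>x \<in> topspace X. h (gen x) = f x)))"

text \<open>A formula of HOL cannot quantify over all types, so the test groups \<open>H\<close> have carriers in the type of
  words. This is no restriction: lemma \<open>free_topology_universal\<close> below gives the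
  universal property for paratopological groups over every type.\<close>

definition is_free_topology :: "'a topology \<Rightarrow> 'a word topology \<Rightarrow> bool" where
  "is_free_topology X T \<longleftrightarrow>
     paratopological_group (free_group (topspace X)) T \<and>
     embedding_map X T gen \<and>
     generate (free_group (topspace X)) (gen ` topspace X) = carrier (free_group (topspace X)) \<and>
     (\<forall>(H :: 'a word monoid) T\<^sub>H. paratopological_group H T\<^sub>H \<longrightarrow> extends_continuous_maps X T H T\<^sub>H)"

definition free_topology :: "'a topology \<Rightarrow> 'a word topology" where
  "free_topology X = (THE T. is_free_topology X T)"

text \<open>Existence and uniqueness: the free topology is the supremum of the following family.\<close>

definition admissible :: "'a topology \<Rightarrow> 'a word topology \<Rightarrow> bool" where
  "admissible X T \<longleftrightarrow> paratopological_group (free_group (topspace X)) T \<and> continuous_map X T gen"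

definition sup_admissible :: "'a topology \<Rightarrow> 'a word topology" where
  "sup_admissible X = topology_generated_by {U. \<exists>T. admissible X T \<and> openin T U}"

lemma paratopological_group_pullback:
  assumes H: "paratopological_group H T" and G: "group G" and h: "h \<in> hom G H"
  shows "paratopological_group G (pullback_topology (carrier G) h T)" (is "paratopological_group G ?P")
    and "continuous_map (pullback_topology (carrier G) h T) T h"
proof -
  interpret G: group G by fact
  have top: "topspace ?P = carrier G"
    using H h by (auto simp: topspace_pullback_topology paratopological_group_def hom_def)
  show ch: "continuous_map ?P T h"
    using continuous_map_pullback[OF continuous_map_id[of T], of "carrier G" h] by simp
  have cm: "continuous_map (prod_topology T T) T (\<lambda>(x, y). x \<otimes>\<^bsub>H\<^esub> y)"
    using H by (simp add: paratopological_group_def)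
  have "continuous_map (prod_topology ?P ?P) (prod_topology T T) (\<lambda>p. (h (fst p), h (snd p)))"
    by (intro continuous_map_pairedI continuous_map_compose[OF _ ch, unfolded o_def] 
        continuous_map_fst continuous_map_snd)
  from continuous_map_compose[OF this cm]
  have "continuous_map (prod_topology ?P ?P) T (\<lambda>p. h (fst p) \<otimes>\<^bsub>H\<^esub> h (snd p))"
    by (simp add: o_def)
  then have "continuous_map (prod_topology ?P ?P) T (h \<circ> (\<lambda>(x, y). x \<otimes>\<^bsub>G\<^esub> y))"
    by (rule continuous_map_eq) (use h top in \<open>auto simp: hom_def\<close>)
  then have "continuous_map (prod_topology ?P ?P) ?P (\<lambda>(x, y). x \<otimes>\<^bsub>G\<^esub> y)"
    by (rule continuous_map_pullback') (auto simp: top)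
  then show "paratopological_group G ?P"
    using G top by (simp add: paratopological_group_def)
qed

lemma admissible_pullback:
  assumes H: "paratopological_group H T" and f: "continuous_map X T f"
    and h: "h \<in> hom (free_group (topspace X)) H" and hf: "\<And>x. x \<in> topspace X \<Longrightarrow> h (gen x) = f x"
  shows "admissible X (pullback_topology (carrier (free_group (topspace X))) h T)"
proof -
  have "continuous_map X T (h \<circ> gen)"
    using f by (rule continuous_map_eq) (simp add: hf)
  then show ?thesis
    unfolding admissible_def using paratopological_group_pullback[OF H group_free_group h]
    by (auto intro!: continuous_map_pullback' gen_mem)
qed

lemma hom_extension:
  assumes "paratopological_group H T" and "continuous_map X T f"
  shows "\<exists>h \<in> hom (free_group (topspace X)) H. \<forall>x \<in> topspace X. h (gen x) = f x"
proof -
  have "group H" "f \<in> topspace X \<rightarrow> carrier H"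
    using assms by (auto simp: paratopological_group_def continuous_map_def)
  from word_value_hom[OF this] show ?thesis by blast
qed

lemma openin_sup_admissible: "admissible X T \<Longrightarrow> openin T U \<Longrightarrow> openin (sup_admissible X) U"
  unfolding sup_admissible_def by (rule topology_generated_by_Basis) blast

lemma admissible_indiscrete: 
  "admissible X (pullback_topology (carrier (free_group (topspace X))) 
     (\<lambda>_. \<one>\<^bsub>free_group (topspace X)\<^esub>) (discrete_topology {\<one>\<^bsub>free_group (topspace X)\<^esub>}))"
proof -
  let ?F = "free_group (topspace X)"
  let ?H = "?F\<lparr>carrier := {\<one>\<^bsub>?F\<^esub>}\<rparr>"
  interpret group ?F by (rule group_free_group)
  have gH: "group ?H"
    by (rule subgroup.subgroup_is_group[OF triv_subgroup group_free_group])
  have "paratopological_group ?H (discrete_topology {\<one>\<^bsub>?F\<^esub>})"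
    unfolding paratopological_group_def
    using gH by (simp flip: prod_topology_discrete_topology) (auto simp: mult_free_group reduce_def)
  moreover have "(\<lambda>_. \<one>\<^bsub>?F\<^esub>) \<in> hom ?F ?H" by (auto simp: hom_def mult_free_group reduce_def)
  ultimately show ?thesis
    by (intro admissible_pullback[where H = ?H and f = "\<lambda>_. \<one>\<^bsub>?F\<^esub>"]) auto
qed

lemma topspace_sup_admissible: "topspace (sup_admissible X) = carrier (free_group (topspace X))"
proof
  show "topspace (sup_admissible X) \<subseteq> carrier (free_group (topspace X))"
    by (auto simp: sup_admissible_def admissible_def paratopological_group_def dest: openin_subset)
  have "openin (sup_admissible X) (topspace T)" if "admissible X T" for T
    using that by (auto intro: openin_sup_admissible)
  from this[OF admissible_indiscrete] show "carrier (free_group (topspace X)) \<subseteq> topspace (sup_admissible X)"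
    using admissible_indiscrete[of X]
    by (auto simp: admissible_def paratopological_group_def dest!: openin_subset)
qed

lemma paratopological_group_sup_admissible:
  "paratopological_group (free_group (topspace X)) (sup_admissible X)" (is "paratopological_group ?F ?S")
proof -
  interpret group ?F by (rule group_free_group)
  let ?m = "\<lambda>(x, y). x \<otimes>\<^bsub>?F\<^esub> y"
  have "continuous_map (prod_topology ?S ?S) ?S ?m"
    unfolding sup_admissible_def
  proof (rule continuous_on_generated_topo; fold sup_admissible_def)
    fix U assume "U \<in> {U. \<exists>T. admissible X T \<and> openin T U}"
    then obtain T where T: "admissible X T" "openin T U" by blast
    then have pT: "paratopological_group ?F T" by (simp add: admissible_def)
    have "continuous_map ?S T id"
      using T pT by (auto simp: continuous_map_def topspace_sup_admissible paratopological_group_def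
          intro: openin_sup_admissible openin_subset[THEN subsetD] 
          dest: openin_subset simp flip: Collect_conj_eq)
        (metis (no_types, lifting) Collect_cong Int_absorb1 Int_def T(1) openin_sup_admissible openin_subset Int_commute)
    then have "continuous_map (prod_topology ?S ?S) (prod_topology T T) (\<lambda>p. (fst p, snd p))"
      using continuous_map_compose[OF continuous_map_fst \<open>continuous_map ?S T id\<close>]
        continuous_map_compose[OF continuous_map_snd \<open>continuous_map ?S T id\<close>]
      by (intro continuous_map_pairedI) (auto simp: o_def)
    from continuous_map_compose[OF this] pT
    have "continuous_map (prod_topology ?S ?S) T ?m"
      by (force simp: paratopological_group_def o_def)
    then show "openin (prod_topology ?S ?S) (?m -` U \<inter> topspace (prod_topology ?S ?S))"
      using T(2) by (auto simp: continuous_map_def vimage_def Int_def conj_commute)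
  next
    show "?m ` topspace (prod_topology ?S ?S) \<subseteq> \<Union>{U. \<exists>T. admissible X T \<and> openin T U}"
      using topspace_sup_admissible[of X] unfolding sup_admissible_def topology_generated_by_topspace
      by auto
  qed
  then show ?thesis
    by (simp add: paratopological_group_def topspace_sup_admissible group_free_group)
qed

lemma continuous_map_gen_sup_admissible: "continuous_map X (sup_admissible X) gen"
  unfolding sup_admissible_def
proof (rule continuous_on_generated_topo)
  fix U assume "U \<in> {U. \<exists>T. admissible X T \<and> openin T U}"
  then show "openin X (gen -` U \<inter> topspace X)"
    by (auto simp: admissible_def continuous_map_def vimage_def Int_def conj_commute)
next
  show "gen ` topspace X \<subseteq> \<Union> {U. \<exists>T. admissible X T \<and> openin T U}"
    using topspace_sup_admissible[of X] unfolding sup_admissible_def topology_generated_by_topspace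
    by (auto intro: gen_mem)
qed

lemma sup_admissible_universal:
  assumes H: "paratopological_group H T"
  shows "extends_continuous_maps X (sup_admissible X) H T"
  unfolding extends_continuous_maps_def
proof (intro allI impI)
  fix f assume f: "continuous_map X T f"
  obtain h where h: "h \<in> hom (free_group (topspace X)) H" "\<forall>x \<in> topspace X. h (gen x) = f x"
    using hom_extension[OF H f] by blast
  let ?C = "carrier (free_group (topspace X))"
  let ?P = "pullback_topology ?C h T"
  have adm: "admissible X ?P" using h by (intro admissible_pullback[OF H f]) auto
  have "continuous_map (sup_admissible X) T h"
    unfolding continuous_map_alt
  proof (intro conjI strip)
    fix U assume "openin T U"
    then have "openin ?P (h -` U \<inter> ?C)" by (auto simp: openin_pullback_topology)
    then show "openin (sup_admissible X) (h -` U \<inter> topspace (sup_admissible X))"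
      unfolding topspace_sup_admissible by (rule openin_sup_admissible[OF adm])
  next
    show "h \<in> topspace (sup_admissible X) \<rightarrow> topspace T"
      using h H by (auto simp: topspace_sup_admissible hom_def paratopological_group_def)
  qed
  then show "\<exists>h\<in>hom (free_group (topspace X)) H. continuous_map (sup_admissible X) T h \<and> 
      (\<forall>x\<in>topspace X. h (gen x) = f x)"
    using h by blast
qed


lemma embedding_sup_admissible: "embedding_map X (sup_admissible X) gen"
proof -
  let ?S = "sup_admissible X"
  have "\<exists>W. openin ?S W \<and> gen ` U = W \<inter> gen ` topspace X" if U: "openin X U" for U
  proof -
    define H :: "int monoid" where "H = \<lparr>carrier = UNIV, monoid.mult = (+), one = 0\<rparr>"
    define T :: "int topology" where "T = topology_generated_by (range greaterThan)"
    have "group H"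
      by (rule groupI) (auto simp: H_def intro: exI[of _ "- _"])
    have topT: "topspace T = UNIV"
      by (auto simp: T_def) (metis lt_ex)
    have openT: "openin T {a<..}" for a
      unfolding T_def by (rule topology_generated_by_Basis) blast
    have "continuous_map (prod_topology T T) T (\<lambda>(x, y). x + y)"
      unfolding T_def
    proof (rule continuous_on_generated_topo; fold T_def)
      fix V assume "V \<in> range (greaterThan :: int \<Rightarrow> int set)"
      then obtain a where V: "V = {a<..}" by blast
      have "\<exists>A B. openin T A \<and> openin T B \<and> x \<in> A \<and> y \<in> B \<and> A \<times> B \<subseteq> (\<lambda>(x, y). x + y) -` V"
        if "x + y \<in> V" for x y
        using that by (intro exI[of _ "{x - 1<..}"] exI[of _ "{y - 1<..}"]) (auto simp: V openT)
      then show "openin (prod_topology T T) ((\<lambda>(x, y). x + y) -` V \<inter> topspace (prod_topology T T))"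
        by (auto simp: openin_prod_topology_alt topT)
    next
      show "(\<lambda>(x, y). x + y) ` topspace (prod_topology T T) \<subseteq> \<Union> (range greaterThan)"
        using lt_ex by auto
    qed
    then have pH: "paratopological_group H T"
      using \<open>group H\<close> topT by (simp add: paratopological_group_def H_def)
    define f :: "'a \<Rightarrow> int" where "f x = (if x \<in> U then 1 else 0)" for x
    have "continuous_map X T f"
      unfolding T_def
    proof (rule continuous_on_generated_topo)
      fix V assume "V \<in> range (greaterThan :: int \<Rightarrow> int set)"
      then obtain a where V: "V = {a<..}" by blast
      have "f -` V \<inter> topspace X = (if a < 0 then topspace X else if a < 1 then U else {})"
        using openin_subset[OF U] by (cases "a < 0"; cases "a < 1"; fastforce simp: V f_def split: if_splits)
      then show "openin X (f -` V \<inter> topspace X)" using U by simp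
    next
      show "f ` topspace X \<subseteq> \<Union> (range greaterThan)" using lt_ex by auto
    qed
    with sup_admissible_universal[OF pH, of X]
    obtain h where h: "continuous_map ?S T h" "\<forall>x\<in>topspace X. h (gen x) = f x"
      unfolding extends_continuous_maps_def by blast
    have "openin ?S (h -` {0<..} \<inter> topspace ?S)"
      using h(1) openT[of 0] unfolding continuous_map_alt by blast
    moreover have "gen ` U = (h -` {0<..} \<inter> topspace ?S) \<inter> gen ` topspace X"
    proof -
      have "gen x \<in> topspace ?S" if "x \<in> topspace X" for x
        using that by (simp add: topspace_sup_admissible gen_mem)
      moreover have "h (gen x) > 0 \<longleftrightarrow> x \<in> U" if "x \<in> topspace X" for x
        using h(2) that by (simp add: f_def)
      ultimately show ?thesis using openin_subset[OF U] by auto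
    qed
    ultimately show ?thesis by blast
  qed
  then have op: "open_map X (subtopology ?S (gen ` topspace X)) gen"
    by (auto simp: open_map_def openin_subtopology)
  have cont: "continuous_map X (subtopology ?S (gen ` topspace X)) gen"
    by (simp add: continuous_map_in_subtopology continuous_map_gen_sup_admissible)
  have onto: "gen ` topspace X = topspace (subtopology ?S (gen ` topspace X))"
    by (auto simp: topspace_sup_admissible gen_mem)
  show ?thesis
    unfolding embedding_map_def
    by (rule bijective_open_imp_homeomorphic_map[OF cont op onto inj_on_subset[OF inj_gen subset_UNIV]])
qed

lemma hom_fixing_gens:
  assumes h: "h \<in> hom (free_group S) (free_group S)" and gens: "\<And>x. x \<in> S \<Longrightarrow> h (gen x) = gen x"
    and w: "w \<in> carrier (free_group S)"
  shows "h w = w"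
proof -
  interpret group_hom "free_group S" "free_group S" h
    using h by (simp add: group_hom_def group_hom_axioms_def group_free_group)
  have "w \<in> generate (free_group S) (gen ` S)" using w by (simp add: generate_free_group)
  then show ?thesis
  proof induction
    case (eng u v)
    then show ?case using generate_free_group[of S] by simp
  qed (use gens in \<open>auto simp: gen_mem simp del: one_free_group\<close>)
qed

lemma is_free_topology_sup_admissible: "is_free_topology X (sup_admissible X)"
  unfolding is_free_topology_def
  by (simp add: paratopological_group_sup_admissible embedding_sup_admissible generate_free_group
      sup_admissible_universal)

lemma is_free_topology_unique:
  assumes T: "is_free_topology X T"
  shows "T = sup_admissible X"
proof (rule topology_eq[THEN iffD2], intro allI iffI)
  have pT: "paratopological_group (free_group (topspace X)) T" and emb: "embedding_map X T gen"
    and univ: "\<And>(H :: 'a word monoid) T\<^sub>H. paratopological_group H T\<^sub>H \<Longrightarrow> extends_continuous_maps X T H T\<^sub>H"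
    using T by (auto simp: is_free_topology_def)
  have "continuous_map X T gen"
    using emb unfolding embedding_map_def
    by (metis continuous_map_in_subtopology homeomorphic_imp_continuous_map)
  then have adm: "admissible X T" using pT by (simp add: admissible_def)
  fix U
  show "openin (sup_admissible X) U" if "openin T U"
    using adm that by (rule openin_sup_admissible)
  obtain h where h: "h \<in> hom (free_group (topspace X)) (free_group (topspace X))"
    "continuous_map T (sup_admissible X) h" "\<forall>x\<in>topspace X. h (gen x) = gen x"
    using univ[OF paratopological_group_sup_admissible[of X]] continuous_map_gen_sup_admissible[of X]
    unfolding extends_continuous_maps_def by blast
  have topT: "topspace T = carrier (free_group (topspace X))"
    using pT by (simp add: paratopological_group_def)
  show "openin T U" if U: "openin (sup_admissible X) U"
  proof -
    have "openin T (h -` U \<inter> topspace T)"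
      using h(2) U unfolding continuous_map_alt by blast
    moreover have "h -` U \<inter> topspace T = U"
      using hom_fixing_gens[OF h(1)] h(3) openin_subset[OF U]
      by (auto simp: topT topspace_sup_admissible)
    ultimately show ?thesis by simp
  qed
qed

lemma free_topology_eq: "free_topology X = sup_admissible X"
  unfolding free_topology_def
  using is_free_topology_sup_admissible is_free_topology_unique by (rule the_equality)

theorem is_free_topology_free_topology: "is_free_topology X (free_topology X)"
  by (simp add: free_topology_eq is_free_topology_sup_admissible)

theorem free_topology_universal:
  fixes H :: "('b, 'c) monoid_scheme"
  assumes "paratopological_group H T\<^sub>H"
  shows "extends_continuous_maps X (free_topology X) H T\<^sub>H"
  using assms by (simp add: free_topology_eq sup_admissible_universal)


section \<open>The Graev topology\<close>

definition quasi_pseudometric_on :: "'a set \<Rightarrow> ('a \<Rightarrow> 'a \<Rightarrow> real) \<Rightarrow> bool" where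
  "quasi_pseudometric_on S d \<longleftrightarrow>
     (\<forall>x\<in>S. \<forall>y\<in>S. 0 \<le> d x y) \<and> (\<forall>x\<in>S. d x x = 0) \<and>
     (\<forall>x\<in>S. \<forall>y\<in>S. \<forall>z\<in>S. d x y \<le> d x z + d z y)"

definition upper_semicontinuous :: "'a topology \<Rightarrow> ('a \<Rightarrow> real) \<Rightarrow> bool" where
  "upper_semicontinuous X f \<longleftrightarrow> (\<forall>a. openin X {x \<in> topspace X. f x < a})"

definition graev_family :: "'a topology \<Rightarrow> ('a \<Rightarrow> 'a \<Rightarrow> real) set" where
  "graev_family X = {d. quasi_pseudometric_on (topspace X) d \<and>
     (\<forall>x\<in>topspace X. \<forall>y\<in>topspace X. d x y \<le> 1) \<and>
     (\<forall>x\<in>topspace X. upper_semicontinuous X (\<lambda>y. d x y))}"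

text \<open>The functions \<open>d\<^sub>e\<close> and \<open>d\<^sup>*\<close>. The letters \<open>x\<close>, \<open>e\<close>, \<open>x\<^sup>-\<^sup>1\<close> are taken as elements of the free group,
  and \<open>the_inv gen\<close> recovers the point from a generator.\<close>

definition dist_e :: "'a set \<Rightarrow> ('a \<Rightarrow> 'a \<Rightarrow> real) \<Rightarrow> 'a word \<Rightarrow> 'a word \<Rightarrow> real" where
  "dist_e S d u v =
     (if u = v then 0
      else if u \<in> gen ` S \<and> v \<in> gen ` S then d (the_inv gen u) (the_inv gen v)
      else 1)"

definition dist_star :: "'a set \<Rightarrow> ('a \<Rightarrow> 'a \<Rightarrow> real) \<Rightarrow> 'a word \<Rightarrow> 'a word \<Rightarrow> real" where
  "dist_star S d u v =
     (let e = \<one>\<^bsub>free_group S\<^esub> in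
      if u = v then 0
      else if u \<in> gen ` S \<union> {e} \<and> v \<in> gen ` S \<union> {e} then dist_e S d u v
      else if u \<in> inverses S S \<union> {e} \<and> v \<in> inverses S S \<union> {e}
        then dist_e S d (inv\<^bsub>free_group S\<^esub> v) (inv\<^bsub>free_group S\<^esub> u)
      else 2)"

definition alphabet :: "'a set \<Rightarrow> 'a word set" where
  "alphabet S = gen ` S \<union> {\<one>\<^bsub>free_group S\<^esub>} \<union> inverses S S"

definition scheme :: "nat \<Rightarrow> (nat \<Rightarrow> nat) \<Rightarrow> bool" where
  "scheme n \<phi> \<longleftrightarrow> bij_betw \<phi> {1..2 * n} {1..2 * n} \<and>
     (\<forall>i\<in>{1..2 * n}. \<phi> i \<noteq> i \<and> \<phi> (\<phi> i) = i) \<and>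
     \<not> (\<exists>i\<in>{1..2 * n}. \<exists>j\<in>{1..2 * n}. i < j \<and> j < \<phi> i \<and> \<phi> i < \<phi> j)"

definition represented :: "'a set \<Rightarrow> 'a word list \<Rightarrow> 'a word" where
  "represented S xs = foldr (\<lambda>u v. u \<otimes>\<^bsub>free_group S\<^esub> v) xs \<one>\<^bsub>free_group S\<^esub>"

text \<open>The letter \<open>x\<^sub>i\<close>, for \<open>i\<close> in \<open>{1..2n}\<close>, is \<open>xs ! (i - 1)\<close>.\<close>

definition scheme_cost ::
    "'a set \<Rightarrow> ('a \<Rightarrow> 'a \<Rightarrow> real) \<Rightarrow> nat \<Rightarrow> 'a word list \<Rightarrow> (nat \<Rightarrow> nat) \<Rightarrow> real" where
  "scheme_cost S d n xs \<phi> =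
     (\<Sum>i = 1..2 * n. dist_star S d (inv\<^bsub>free_group S\<^esub> (xs ! (i - 1))) (xs ! (\<phi> i - 1))) / 2"

definition graev_norm :: "'a set \<Rightarrow> ('a \<Rightarrow> 'a \<Rightarrow> real) \<Rightarrow> 'a word \<Rightarrow> real" where
  "graev_norm S d g =
     (if g = \<one>\<^bsub>free_group S\<^esub> then 0
      else Inf {scheme_cost S d n xs \<phi> | n xs \<phi>.
                  n \<ge> 1 \<and> length xs = 2 * n \<and> set xs \<subseteq> alphabet S \<and> represented S xs = g \<and> scheme n \<phi>})"

definition graev_dist :: "'a set \<Rightarrow> ('a \<Rightarrow> 'a \<Rightarrow> real) \<Rightarrow> 'a word \<Rightarrow> 'a word \<Rightarrow> real" where
  "graev_dist S d g h = graev_norm S d (inv\<^bsub>free_group S\<^esub> g \<otimes>\<^bsub>free_group S\<^esub> h)"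

definition graev_ball :: "'a set \<Rightarrow> ('a \<Rightarrow> 'a \<Rightarrow> real) \<Rightarrow> 'a word \<Rightarrow> real \<Rightarrow> 'a word set" where
  "graev_ball S d g \<epsilon> = {h \<in> carrier (free_group S). graev_dist S d g h < \<epsilon>}"

text \<open>The topology of the quasi-pseudometric \<open>graev_dist S d\<close>. Since \<open>graev_ball S d g \<epsilon>\<close> is the left translate by
  \<open>g\<close> of \<open>graev_ball S d e \<epsilon>\<close>, this is the paratopological group topology for which the balls around \<open>e\<close> form
  a base at \<open>e\<close>; see \<open>graev_topology_of_iff\<close> below.\<close>

definition graev_topology_of :: "'a set \<Rightarrow> ('a \<Rightarrow> 'a \<Rightarrow> real) \<Rightarrow> 'a word topology" where
  "graev_topology_of S d =
     topology (\<lambda>U. U \<subseteq> carrier (free_group S) \<and> (\<forall>g\<in>U. \<exists>\<epsilon>>0. graev_ball S d g \<epsilon> \<subseteq> U))"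

definition graev_topology :: "'a topology \<Rightarrow> 'a word topology" where
  "graev_topology X =
     topology_generated_by (\<Union>d\<in>graev_family X. {U. openin (graev_topology_of (topspace X) d) U})"

lemma openin_graev_topology_of:
  "openin (graev_topology_of S d) U \<longleftrightarrow>
     U \<subseteq> carrier (free_group S) \<and> (\<forall>g\<in>U. \<exists>\<epsilon>>0. graev_ball S d g \<epsilon> \<subseteq> U)"
proof -
  let ?L = "\<lambda>U. U \<subseteq> carrier (free_group S) \<and> (\<forall>g\<in>U. \<exists>\<epsilon>>0. graev_ball S d g \<epsilon> \<subseteq> U)"
  have 1: "?L (U \<inter> V)" if UV: "?L U" "?L V" for U V
  proof (intro conjI ballI)
    fix g assume "g \<in> U \<inter> V"
    then obtain \<epsilon>1 \<epsilon>2 where "\<epsilon>1 > 0" "\<epsilon>2 > 0" "graev_ball S d g \<epsilon>1 \<subseteq> U" "graev_ball S d g \<epsilon>2 \<subseteq> V"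
      using bspec[OF conjunct2[OF UV(1)], of g] bspec[OF conjunct2[OF UV(2)], of g] by auto
    moreover have "graev_ball S d g (min \<epsilon>1 \<epsilon>2) \<subseteq> graev_ball S d g \<epsilon>1 \<inter> graev_ball S d g \<epsilon>2"
      by (auto simp: graev_ball_def)
    ultimately show "\<exists>\<epsilon>>0. graev_ball S d g \<epsilon> \<subseteq> U \<inter> V"
      by (intro exI[of _ "min \<epsilon>1 \<epsilon>2"]) force
  qed (use conjunct1[OF UV(1)] in fast)
  have 2: "?L (\<Union>K)" if K: "\<forall>U\<in>K. ?L U" for K
  proof (intro conjI ballI)
    fix g assume "g \<in> \<Union>K"
    then obtain U where U: "U \<in> K" "g \<in> U" by blast
    then obtain \<epsilon> where "\<epsilon> > 0" "graev_ball S d g \<epsilon> \<subseteq> U"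
      using bspec[OF K U(1)] by auto
    then have "graev_ball S d g \<epsilon> \<subseteq> \<Union>K" using U(1) by (meson Union_upper subset_trans)
    then show "\<exists>\<epsilon>>0. graev_ball S d g \<epsilon> \<subseteq> \<Union>K" using \<open>\<epsilon> > 0\<close> by auto
  qed (use bspec[OF K, THEN conjunct1] in \<open>rule Union_least\<close>)
  have "istopology ?L"
    unfolding istopology_def by (rule conjI; intro allI impI; (rule 1 | rule 2); assumption)
  then show ?thesis by (simp add: graev_topology_of_def)
qed

lemma topspace_graev_topology_of: "topspace (graev_topology_of S d) = carrier (free_group S)"
proof
  show "topspace (graev_topology_of S d) \<subseteq> carrier (free_group S)"
    using openin_graev_topology_of[THEN iffD1, OF openin_topspace] by (rule conjunct1)
  have "openin (graev_topology_of S d) (carrier (free_group S))"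
    unfolding openin_graev_topology_of
    by (intro conjI ballI exI[of _ "1 :: real"]) (simp_all add: graev_ball_def)
  then show "carrier (free_group S) \<subseteq> topspace (graev_topology_of S d)" by (rule openin_subset)
qed

text \<open>The remainder checks that \<open>graev_topology_of\<close> is a paratopological group topology with the stated base
  at the identity, and the only one.\<close>

lemma schemeI:
  assumes "\<And>i. i \<in> {1..2 * n} \<Longrightarrow> \<phi> i \<in> {1..2 * n}" 
    and "\<And>i. i \<in> {1..2 * n} \<Longrightarrow> \<phi> i \<noteq> i" "\<And>i. i \<in> {1..2 * n} \<Longrightarrow> \<phi> (\<phi> i) = i"
    and "\<And>i j. \<lbrakk>i \<in> {1..2 * n}; j \<in> {1..2 * n}; i < j; j < \<phi> i; \<phi> i < \<phi> j\<rbrakk> \<Longrightarrow> False"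
  shows "scheme n \<phi>"
  unfolding scheme_def
  using assms by (auto intro!: bij_betw_byWitness[where f' = \<phi>])

lemma scheme_range: "scheme n \<phi> \<Longrightarrow> i \<in> {1..2 * n} \<Longrightarrow> \<phi> i \<in> {1..2 * n}"
  unfolding scheme_def by (meson bij_betwE)

lemma scheme_involution: "scheme n \<phi> \<Longrightarrow> i \<in> {1..2 * n} \<Longrightarrow> \<phi> (\<phi> i) = i \<and> \<phi> i \<noteq> i"
  unfolding scheme_def by meson

lemma scheme_noncrossing:
  "scheme n \<phi> \<Longrightarrow> i \<in> {1..2 * n} \<Longrightarrow> j \<in> {1..2 * n} \<Longrightarrow> i < j \<Longrightarrow> j < \<phi> i \<Longrightarrow> \<phi> i < \<phi> j \<Longrightarrow> False"
  unfolding scheme_def by meson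

lemma scheme_concat:
  assumes "scheme n \<phi>" "scheme m \<psi>"
  shows "scheme (n + m) (\<lambda>i. if i \<le> 2 * n then \<phi> i else \<psi> (i - 2 * n) + 2 * n)" (is "scheme _ ?\<chi>")
proof -
  have 1: "?\<chi> i = \<phi> i" "\<phi> i \<ge> 1" "\<phi> i \<le> 2 * n" "\<phi> (\<phi> i) = i" "\<phi> i \<noteq> i" if "1 \<le> i" "i \<le> 2 * n" for i
    using that scheme_range[OF assms(1), of i] scheme_involution[OF assms(1), of i] by auto
  have 2: "?\<chi> i = \<psi> (i - 2 * n) + 2 * n" "\<psi> (i - 2 * n) \<ge> 1" "\<psi> (i - 2 * n) \<le> 2 * m" 
    "\<psi> (\<psi> (i - 2 * n)) = i - 2 * n" "\<psi> (i - 2 * n) \<noteq> i - 2 * n" if "2 * n < i" "i \<le> 2 * n + 2 * m" for i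
  proof -
    have "i - 2 * n \<in> {1..2 * m}" using that by auto
    from scheme_range[OF assms(2) this] scheme_involution[OF assms(2) this] that
    show "?\<chi> i = \<psi> (i - 2 * n) + 2 * n" "\<psi> (i - 2 * n) \<ge> 1" "\<psi> (i - 2 * n) \<le> 2 * m" 
      "\<psi> (\<psi> (i - 2 * n)) = i - 2 * n" "\<psi> (i - 2 * n) \<noteq> i - 2 * n"
      by simp_all
  qed
  show ?thesis
  proof (rule schemeI)
    fix i assume i: "i \<in> {1..2 * (n + m)}"
    show "?\<chi> i \<in> {1..2 * (n + m)}" "?\<chi> i \<noteq> i" "?\<chi> (?\<chi> i) = i"
      using 1[of i] 2[of i] i by (cases "i \<le> 2 * n"; force)+
    fix j assume j: "j \<in> {1..2 * (n + m)}" "i < j" "j < ?\<chi> i" "?\<chi> i < ?\<chi> j"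
    show False
    proof (cases "i \<le> 2 * n")
      case True
      then have "j \<le> 2 * n" using 1[of i] i j by auto
      then show False using True scheme_noncrossing[OF assms(1), of i j] i j by auto
    next
      case False
      then have "i - 2 * n \<in> {1..2 * m}" "j - 2 * n \<in> {1..2 * m}" "i - 2 * n < j - 2 * n"
        "j - 2 * n < \<psi> (i - 2 * n)" "\<psi> (i - 2 * n) < \<psi> (j - 2 * n)"
        using i j by auto
      then show False by (rule scheme_noncrossing[OF assms(2)])
    qed
  qed
qed

lemma scheme_nest:
  assumes "scheme n \<phi>"
  shows "scheme (n + 1) (\<lambda>i. if i = 1 then 2 * n + 2 else if i = 2 * n + 2 then 1 else \<phi> (i - 1) + 1)"
    (is "scheme _ ?\<chi>")
proof -
  have 1: "?\<chi> i = \<phi> (i - 1) + 1" "\<phi> (i - 1) \<ge> 1" "\<phi> (i - 1) \<le> 2 * n" "\<phi> (\<phi> (i - 1)) = i - 1" "\<phi> (i - 1) \<noteq> i - 1"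
    if "1 < i" "i < 2 * n + 2" for i
  proof -
    have "i - 1 \<in> {1..2 * n}" using that by auto
    from scheme_range[OF assms this] scheme_involution[OF assms this] that
    show "?\<chi> i = \<phi> (i - 1) + 1" "\<phi> (i - 1) \<ge> 1" "\<phi> (i - 1) \<le> 2 * n" "\<phi> (\<phi> (i - 1)) = i - 1" 
      "\<phi> (i - 1) \<noteq> i - 1"
      by simp_all
  qed
  show ?thesis
  proof (rule schemeI)
    fix i assume i: "i \<in> {1..2 * (n + 1)}"
    then consider "i = 1" | "i = 2 * n + 2" | "1 < i" "i < 2 * n + 2" by force
    note c = this
    show "?\<chi> i \<in> {1..2 * (n + 1)}" "?\<chi> i \<noteq> i" "?\<chi> (?\<chi> i) = i"
      using c by (cases; use 1[of i] in force)+
    fix j assume j: "j \<in> {1..2 * (n + 1)}" "i < j" "j < ?\<chi> i" "?\<chi> i < ?\<chi> j"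
    show False
      using c
    proof cases
      case 1
      then show False using j \<open>\<And>i. 1 < i \<Longrightarrow> i < 2 * n + 2 \<Longrightarrow> \<phi> (i - 1) \<le> 2 * n\<close>[of j]
        by (auto split: if_splits)
    next
      case 2
      then show False using j by auto
    next
      case 3
      note i' = 1[OF 3]
      have j1: "j < \<phi> (i - 1) + 1" using j(3) unfolding i'(1) .
      have "1 < j" "j < 2 * n + 2" using 3 j(2) j1 i'(3) by auto
      have "\<phi> (i - 1) + 1 < \<phi> (j - 1) + 1"
        using j(4) unfolding i'(1) 1(1)[OF \<open>1 < j\<close> \<open>j < 2 * n + 2\<close>] .
      then have "\<phi> (i - 1) < \<phi> (j - 1)" by simp
      moreover have "j - 1 < \<phi> (i - 1)" "i - 1 < j - 1" using j1 j(2) 3 by linarith+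
      moreover have "i - 1 \<in> {1..2 * n}" "j - 1 \<in> {1..2 * n}"
        using 3 \<open>1 < j\<close> \<open>j < 2 * n + 2\<close> by auto
      ultimately show False by (blast intro: scheme_noncrossing[OF assms])
    qed
  qed
qed

lemma scheme_cost_concat:
  assumes "length xs = 2 * n" "scheme n \<phi>" "scheme m \<psi>"
  shows "scheme_cost S d (n + m) (xs @ ys) (\<lambda>i. if i \<le> 2 * n then \<phi> i else \<psi> (i - 2 * n) + 2 * n) =
         scheme_cost S d n xs \<phi> + scheme_cost S d m ys \<psi>"
proof -
  let ?\<chi> = "\<lambda>i. if i \<le> 2 * n then \<phi> i else \<psi> (i - 2 * n) + 2 * n"
  let ?f = "\<lambda>i. dist_star S d (inv\<^bsub>free_group S\<^esub> ((xs @ ys) ! (i - 1))) ((xs @ ys) ! (?\<chi> i - 1))"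
  have "(\<Sum>i = 1..2 * (n + m). ?f i) = (\<Sum>i = 1..2 * n. ?f i) + (\<Sum>i = 2 * n + 1..2 * n + 2 * m. ?f i)"
    using sum.ub_add_nat[of 1 "2 * n" ?f "2 * m"] by (simp only: distrib_left)
  also have "(\<Sum>i = 2 * n + 1..2 * n + 2 * m. ?f i) = (\<Sum>i = 1..2 * m. ?f (i + 2 * n))"
    using sum.shift_bounds_cl_nat_ivl[of ?f 1 "2 * n" "2 * m"] by (simp only: add.commute)
  also have "\<dots> = (\<Sum>i = 1..2 * m. dist_star S d (inv\<^bsub>free_group S\<^esub> (ys ! (i - 1))) (ys ! (\<psi> i - 1)))"
  proof (rule sum.cong)
    fix i assume i: "i \<in> {1..2 * m}"
    have "i + 2 * n - 1 = length xs + (i - 1)" "?\<chi> (i + 2 * n) - 1 = length xs + (\<psi> i - 1)"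
      using i scheme_range[OF assms(3) i] assms(1) by auto
    then show "?f (i + 2 * n) = dist_star S d (inv\<^bsub>free_group S\<^esub> (ys ! (i - 1))) (ys ! (\<psi> i - 1))"
      by (simp only: nth_append_length_plus)
  qed simp
  also have "(\<Sum>i = 1..2 * n. ?f i) = (\<Sum>i = 1..2 * n. dist_star S d (inv\<^bsub>free_group S\<^esub> (xs ! (i - 1))) (xs ! (\<phi> i - 1)))"
  proof (rule sum.cong)
    fix i assume i: "i \<in> {1..2 * n}"
    have "i - 1 < 2 * n" "\<phi> i - 1 < 2 * n" "i \<le> 2 * n"
      using i scheme_range[OF assms(2) i] by auto
    then show "?f i = dist_star S d (inv\<^bsub>free_group S\<^esub> (xs ! (i - 1))) (xs ! (\<phi> i - 1))"
      using assms(1) by (simp add: nth_append)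
  qed simp
  finally show ?thesis by (simp add: scheme_cost_def add_divide_distrib)
qed

lemma sum_split_ends:
  "(\<Sum>i = 1..2 * (n + 1). f i) = f 1 + (\<Sum>i = 1..2 * n. f (i + 1)) + f (2 * n + 2)"
  for f :: "nat \<Rightarrow> real"
proof -
  have "(\<Sum>i = 1..2 * (n + 1). f i) = (\<Sum>i = 1..Suc (2 * n). f i) + f (2 * n + 2)"
    by (simp add: add.commute)
  also have "(\<Sum>i = 1..Suc (2 * n). f i) = f 1 + (\<Sum>i = Suc 1..Suc (2 * n). f i)"
    by (rule sum.atLeast_Suc_atMost) simp
  also have "(\<Sum>i = Suc 1..Suc (2 * n). f i) = (\<Sum>i = 1..2 * n. f (i + 1))"
    using sum.shift_bounds_cl_Suc_ivl[of f 1 "2 * n"] by simp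
  finally show ?thesis .
qed

lemma alphabet_mem: "a \<in> alphabet S \<Longrightarrow> a \<in> carrier (free_group S)"
  using group.inv_closed[OF group_free_group, of _ S] group.is_monoid[OF group_free_group, of S]
  by (auto simp: alphabet_def inverses_def gen_mem carrier_free_group[of S, THEN arg_cong[where f = "\<lambda>A. [] \<in> A"]])

lemma alphabet_inv: "a \<in> alphabet S \<Longrightarrow> inv\<^bsub>free_group S\<^esub> a \<in> alphabet S"
proof -
  interpret group "free_group S" by (rule group_free_group)
  show "a \<in> alphabet S \<Longrightarrow> inv\<^bsub>free_group S\<^esub> a \<in> alphabet S"
    by (auto simp: alphabet_def inverses_def gen_mem inv_one[unfolded one_free_group])
qed

lemma alphabet_iff: "[a] \<in> alphabet S \<longleftrightarrow> fst a \<in> S"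
proof -
  have "[a] \<in> alphabet S \<longleftrightarrow> [a] \<in> gen ` S \<or> [a] \<in> inverses S S" by (auto simp: alphabet_def)
  then show ?thesis 
    by (cases a; cases "snd a") (auto simp: inverses_eq gen_def)
qed

lemma represented_mem: "set xs \<subseteq> alphabet S \<Longrightarrow> represented S xs \<in> carrier (free_group S)"
proof -
  interpret group "free_group S" by (rule group_free_group)
  show "set xs \<subseteq> alphabet S \<Longrightarrow> represented S xs \<in> carrier (free_group S)"
    by (induction xs) (auto simp: represented_def alphabet_mem one_closed[unfolded one_free_group])
qed

lemma represented_append:
  assumes "set xs \<subseteq> alphabet S" "set ys \<subseteq> alphabet S"
  shows "represented S (xs @ ys) = represented S xs \<otimes>\<^bsub>free_group S\<^esub> represented S ys"
proof -
  interpret group "free_group S" by (rule group_free_group)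
  have Cons: "represented S (a # zs) = a \<otimes>\<^bsub>free_group S\<^esub> represented S zs" for a zs 
    by (simp add: represented_def)
  have Empty: "represented S [] = \<one>\<^bsub>free_group S\<^esub>" by (simp add: represented_def)
  show ?thesis
    using assms(1)
  proof (induction xs)
    case Nil
    then show ?case using represented_mem[OF assms(2)] by (simp add: Empty del: one_free_group)
  next
    case (Cons a xs)
    then show ?case using represented_mem[OF assms(2)] represented_mem[of xs S]
      by (simp add: \<open>\<And>zs a. represented S (a # zs) = _\<close> m_assoc alphabet_mem)
  qed
qed

definition graev_costs :: "'a set \<Rightarrow> ('a \<Rightarrow> 'a \<Rightarrow> real) \<Rightarrow> 'a word \<Rightarrow> real set" where
  "graev_costs S d g = {scheme_cost S d n xs \<phi> | n xs \<phi>.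
     n \<ge> 1 \<and> length xs = 2 * n \<and> set xs \<subseteq> alphabet S \<and> represented S xs = g \<and> scheme n \<phi>}"

lemma graev_costs_nonempty:
  assumes g: "g \<in> carrier (free_group S)" and "g \<noteq> \<one>\<^bsub>free_group S\<^esub>"
  shows "graev_costs S d g \<noteq> {}"
proof -
  let ?n = "length g"
  let ?xs = "map (\<lambda>a. [a]) g @ replicate ?n \<one>\<^bsub>free_group S\<^esub>"
  have n: "?n \<ge> 1" using assms by (cases g) auto
  have al: "set (map (\<lambda>a. [a]) g) \<subseteq> alphabet S"  "set (replicate ?n \<one>\<^bsub>free_group S\<^esub>) \<subseteq> alphabet S"
    using g by (auto simp: alphabet_iff carrier_free_group alphabet_def[THEN arg_cong[where f = "\<lambda>A. [] \<in> A"]])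
  have "represented S (map (\<lambda>a. [a]) w) = reduce w" for w
    by (induction w) (simp_all add: represented_def mult_free_group reduce_def foldr_reduce[unfolded reduce_def] 
        reduce_id[unfolded reduce_def] reduced_foldr)
  moreover have "represented S (replicate k \<one>\<^bsub>free_group S\<^esub>) = []" for k
    by (induction k) (auto simp: represented_def mult_free_group reduce_def)
  ultimately have "represented S ?xs = g"
    using g by (simp only: represented_append[OF al]) (simp add: mult_free_group reduce_id carrier_free_group)
  moreover have "scheme ?n (\<lambda>i. 2 * ?n + 1 - i)"
    by (rule schemeI) (auto, presburger)
  ultimately show ?thesis
    unfolding graev_costs_def using n al by force
qed

context
  fixes S :: "'a set" and d :: "'a \<Rightarrow> 'a \<Rightarrow> real"
  assumes d: "\<And>x y. x \<in> S \<Longrightarrow> y \<in> S \<Longrightarrow> 0 \<le> d x y"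
begin

interpretation F: group "free_group S" by (rule group_free_group)

lemma dist_star_nonneg: "dist_star S d u v \<ge> 0"
proof -
  have "dist_e S d u v \<ge> 0" for u v
    by (auto simp: dist_e_def the_inv_f_f[OF inj_gen] d)
  then show ?thesis by (auto simp: dist_star_def Let_def)
qed

lemma scheme_cost_nonneg: "scheme_cost S d n xs \<phi> \<ge> 0"
  unfolding scheme_cost_def by (simp add: sum_nonneg dist_star_nonneg)

lemma graev_costs_bdd: "bdd_below (graev_costs S d g)"
  by (rule bdd_belowI[of _ 0]) (auto simp: graev_costs_def scheme_cost_nonneg)

lemma graev_norm_eq: "graev_norm S d g = (if g = \<one>\<^bsub>free_group S\<^esub> then 0 else Inf (graev_costs S d g))"
  by (simp add: graev_norm_def graev_costs_def)

lemma graev_norm_nonneg: 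
  assumes "g \<in> carrier (free_group S)"
  shows "graev_norm S d g \<ge> 0"
proof (cases "g = \<one>\<^bsub>free_group S\<^esub>")
  case False
  have "Inf (graev_costs S d g) \<ge> 0"
    by (rule cInf_greatest[OF graev_costs_nonempty[OF assms False]]) (auto simp: graev_costs_def scheme_cost_nonneg)
  then show ?thesis by (simp add: graev_norm_eq)
qed (simp add: graev_norm_eq)

lemma graev_norm_le: "c \<in> graev_costs S d g \<Longrightarrow> graev_norm S d g \<le> c"
  by (auto simp: graev_norm_eq intro!: cInf_lower graev_costs_bdd) 
     (auto simp: graev_costs_def scheme_cost_nonneg)

lemma graev_costs_approx:
  assumes "g \<in> carrier (free_group S)" "g \<noteq> \<one>\<^bsub>free_group S\<^esub>" "\<epsilon> > 0"
  obtains c where "c \<in> graev_costs S d g" "c < graev_norm S d g + \<epsilon>"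
  using cInf_lessD[OF graev_costs_nonempty[OF assms(1,2), of d], of "graev_norm S d g + \<epsilon>"] assms
  by (auto simp: graev_norm_eq)

lemma graev_norm_mult:
  assumes g: "g \<in> carrier (free_group S)" and h: "h \<in> carrier (free_group S)"
  shows "graev_norm S d (g \<otimes>\<^bsub>free_group S\<^esub> h) \<le> graev_norm S d g + graev_norm S d h"
proof (cases "g = \<one>\<^bsub>free_group S\<^esub> \<or> h = \<one>\<^bsub>free_group S\<^esub>")
  case True
  then show ?thesis using g h by (auto simp: graev_norm_eq simp del: one_free_group)
next
  case False
  show ?thesis
  proof (rule field_le_epsilon)
    fix \<epsilon> :: real assume "\<epsilon> > 0"
    then have "\<epsilon> / 2 > 0" by simp
    obtain c1 where c1: "c1 \<in> graev_costs S d g" "c1 < graev_norm S d g + \<epsilon> / 2"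
      using graev_costs_approx[OF g _ \<open>\<epsilon> / 2 > 0\<close>] False by blast
    obtain c2 where c2: "c2 \<in> graev_costs S d h" "c2 < graev_norm S d h + \<epsilon> / 2"
      using graev_costs_approx[OF h _ \<open>\<epsilon> / 2 > 0\<close>] False by blast
    obtain n xs \<phi> where 1: "c1 = scheme_cost S d n xs \<phi>" "n \<ge> 1" "length xs = 2 * n" "set xs \<subseteq> alphabet S"
      "represented S xs = g" "scheme n \<phi>" using c1(1) by (auto simp: graev_costs_def)
    obtain m ys \<psi> where 2: "c2 = scheme_cost S d m ys \<psi>" "m \<ge> 1" "length ys = 2 * m" "set ys \<subseteq> alphabet S"
      "represented S ys = h" "scheme m \<psi>" using c2(1) by (auto simp: graev_costs_def)
    let ?\<chi> = "\<lambda>i. if i \<le> 2 * n then \<phi> i else \<psi> (i - 2 * n) + 2 * n"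
    have "n + m \<ge> 1 \<and> length (xs @ ys) = 2 * (n + m) \<and> set (xs @ ys) \<subseteq> alphabet S \<and> 
        represented S (xs @ ys) = g \<otimes>\<^bsub>free_group S\<^esub> h \<and> scheme (n + m) ?\<chi>"
      using 1 2 represented_append[of xs S ys] scheme_concat[of n \<phi> m \<psi>] by simp
    moreover have "c1 + c2 = scheme_cost S d (n + m) (xs @ ys) ?\<chi>"
      using 1 2 by (simp add: scheme_cost_concat)
    ultimately have "c1 + c2 \<in> graev_costs S d (g \<otimes>\<^bsub>free_group S\<^esub> h)"
      unfolding graev_costs_def mem_Collect_eq by blast
    then show "graev_norm S d (g \<otimes>\<^bsub>free_group S\<^esub> h) \<le> graev_norm S d g + graev_norm S d h + \<epsilon>"
      using graev_norm_le c1 c2 by fastforce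
  qed
qed

lemma graev_norm_conj_letter:
  assumes g: "g \<in> carrier (free_group S)" and a: "a \<in> alphabet S"
  shows "graev_norm S d (a \<otimes>\<^bsub>free_group S\<^esub> g \<otimes>\<^bsub>free_group S\<^esub> inv\<^bsub>free_group S\<^esub> a) \<le> graev_norm S d g"
proof (cases "g = \<one>\<^bsub>free_group S\<^esub>")
  case True
  then show ?thesis using alphabet_mem[OF a] by (simp add: graev_norm_eq del: one_free_group)
next
  case False
  have aF: "a \<in> carrier (free_group S)" by (rule alphabet_mem[OF a])
  let ?a = "inv\<^bsub>free_group S\<^esub> a"
  show ?thesis
  proof (rule field_le_epsilon)
    fix \<epsilon> :: real assume "\<epsilon> > 0"
    obtain c where c: "c \<in> graev_costs S d g" "c < graev_norm S d g + \<epsilon>"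
      using graev_costs_approx[OF g False \<open>\<epsilon> > 0\<close>] by blast
    obtain n xs \<phi> where 1: "c = scheme_cost S d n xs \<phi>" "n \<ge> 1" "length xs = 2 * n" "set xs \<subseteq> alphabet S"
      "represented S xs = g" "scheme n \<phi>" using c(1) by (auto simp: graev_costs_def)
    let ?\<chi> = "\<lambda>i. if i = 1 then 2 * n + 2 else if i = 2 * n + 2 then 1 else \<phi> (i - 1) + 1"
    let ?xs = "a # xs @ [?a]"
    have al: "set [a] \<subseteq> alphabet S" "set [?a] \<subseteq> alphabet S" using a by (auto intro: alphabet_inv)
    have single: "represented S [b] = b" if "b \<in> alphabet S" for b
      using alphabet_mem[OF that] by (simp add: represented_def del: one_free_group)
    have "represented S ([a] @ xs @ [?a]) = a \<otimes>\<^bsub>free_group S\<^esub> (g \<otimes>\<^bsub>free_group S\<^esub> ?a)"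
      using 1 al by (subst represented_append; simp add: represented_append single)
    then have rep: "represented S ?xs = a \<otimes>\<^bsub>free_group S\<^esub> g \<otimes>\<^bsub>free_group S\<^esub> ?a"
      using aF g by (simp add: F.m_assoc)
    let ?f = "\<lambda>i. dist_star S d (inv\<^bsub>free_group S\<^esub> (?xs ! (i - 1))) (?xs ! (?\<chi> i - 1))"
    have last: "?xs ! (2 * n + 1) = ?a" using 1 by (simp add: nth_append)
    have f1: "?f 1 = 0" using last by (simp add: dist_star_def)
    have f2: "?f (2 * n + 2) = 0" using last aF by (simp add: dist_star_def)
    have f: "?f (i + 1) = dist_star S d (inv\<^bsub>free_group S\<^esub> (xs ! (i - 1))) (xs ! (\<phi> i - 1))" if i: "i \<in> {1..2 * n}" for i
    proof -
      have "1 \<le> i" "i \<le> 2 * n" "1 \<le> \<phi> i" "\<phi> i \<le> 2 * n" using i scheme_range[OF 1(6) i] by auto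
      then show ?thesis using 1(3) by (auto simp: nth_append nth_Cons')
    qed
    have "(\<Sum>i = 1..2 * (n + 1). ?f i) = (\<Sum>i = 1..2 * n. ?f (i + 1))"
      using f1 f2 by (subst sum_split_ends) simp
    also have "\<dots> = (\<Sum>i = 1..2 * n. dist_star S d (inv\<^bsub>free_group S\<^esub> (xs ! (i - 1))) (xs ! (\<phi> i - 1)))"
      by (rule sum.cong[OF refl f])
    finally have "c = scheme_cost S d (n + 1) ?xs ?\<chi>"
      using 1(1) by (simp only: scheme_cost_def)
    moreover have "n + 1 \<ge> 1 \<and> length ?xs = 2 * (n + 1) \<and> set ?xs \<subseteq> alphabet S \<and> 
        represented S ?xs = a \<otimes>\<^bsub>free_group S\<^esub> g \<otimes>\<^bsub>free_group S\<^esub> ?a \<and> scheme (n + 1) ?\<chi>"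
      using 1 al rep scheme_nest[OF 1(6)] by simp
    ultimately have "c \<in> graev_costs S d (a \<otimes>\<^bsub>free_group S\<^esub> g \<otimes>\<^bsub>free_group S\<^esub> ?a)"
      unfolding graev_costs_def mem_Collect_eq by blast
    then show "graev_norm S d (a \<otimes>\<^bsub>free_group S\<^esub> g \<otimes>\<^bsub>free_group S\<^esub> ?a) \<le> graev_norm S d g + \<epsilon>"
      using graev_norm_le c by fastforce
  qed
qed

lemma graev_norm_conj:
  assumes "g \<in> carrier (free_group S)" and x: "x \<in> carrier (free_group S)"
  shows "graev_norm S d (x \<otimes>\<^bsub>free_group S\<^esub> g \<otimes>\<^bsub>free_group S\<^esub> inv\<^bsub>free_group S\<^esub> x) \<le> graev_norm S d g"
proof -
  have "reduced_word x" "fst ` set x \<subseteq> S" using x by (auto simp: carrier_free_group)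
  then show ?thesis
  proof (induction x)
    case Nil
    then show ?case using assms F.r_one[of g] F.l_one[of g] F.inv_one by simp
  next
    case (Cons a x)
    have xF: "x \<in> carrier (free_group S)" 
      using Cons.prems by (auto simp: carrier_free_group dest: reduced_ConsD)
    have a: "[a] \<in> alphabet S" using Cons.prems by (simp add: alphabet_iff)
    have aF: "[a] \<in> carrier (free_group S)" by (rule alphabet_mem[OF a])
    have ax: "a # x = [a] \<otimes>\<^bsub>free_group S\<^esub> x"
      using reduce_id[OF Cons.prems(1)] by (simp add: mult_free_group)
    let ?g = "x \<otimes>\<^bsub>free_group S\<^esub> g \<otimes>\<^bsub>free_group S\<^esub> inv\<^bsub>free_group S\<^esub> x"
    have "(a # x) \<otimes>\<^bsub>free_group S\<^esub> g \<otimes>\<^bsub>free_group S\<^esub> inv\<^bsub>free_group S\<^esub> (a # x) = 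
        [a] \<otimes>\<^bsub>free_group S\<^esub> ?g \<otimes>\<^bsub>free_group S\<^esub> inv\<^bsub>free_group S\<^esub> [a]"
      using xF aF assms by (simp add: ax F.m_assoc F.inv_mult_group)
    moreover have "?g \<in> carrier (free_group S)" using xF assms by simp
    ultimately show ?case
      using graev_norm_conj_letter[OF _ a, of ?g] Cons xF by (auto simp: reduced_ConsD)
  qed
qed

lemma graev_dist_triangle:
  assumes "g \<in> carrier (free_group S)" "h \<in> carrier (free_group S)" "k \<in> carrier (free_group S)"
  shows "graev_dist S d g k \<le> graev_dist S d g h + graev_dist S d h k"
proof -
  have "inv\<^bsub>free_group S\<^esub> g \<otimes>\<^bsub>free_group S\<^esub> k = 
      (inv\<^bsub>free_group S\<^esub> g \<otimes>\<^bsub>free_group S\<^esub> h) \<otimes>\<^bsub>free_group S\<^esub> (inv\<^bsub>free_group S\<^esub> h \<otimes>\<^bsub>free_group S\<^esub> k)"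
    using assms by (metis F.inv_closed F.inv_solve_left F.m_assoc F.m_closed)
  then show ?thesis
    using graev_norm_mult[of "inv\<^bsub>free_group S\<^esub> g \<otimes>\<^bsub>free_group S\<^esub> h" "inv\<^bsub>free_group S\<^esub> h \<otimes>\<^bsub>free_group S\<^esub> k"] assms
    by (simp add: graev_dist_def)
qed

lemma graev_dist_refl: "g \<in> carrier (free_group S) \<Longrightarrow> graev_dist S d g g = 0"
  by (simp add: graev_dist_def graev_norm_eq del: one_free_group)

lemma graev_ball_centre: "g \<in> carrier (free_group S) \<Longrightarrow> \<epsilon> > 0 \<Longrightarrow> g \<in> graev_ball S d g \<epsilon>"
  by (simp add: graev_ball_def graev_dist_refl)

lemma openin_graev_ball: 
  assumes g: "g \<in> carrier (free_group S)"
  shows "openin (graev_topology_of S d) (graev_ball S d g \<epsilon>)"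
  unfolding openin_graev_topology_of
proof (intro conjI ballI)
  fix h assume h: "h \<in> graev_ball S d g \<epsilon>"
  have "graev_ball S d h (\<epsilon> - graev_dist S d g h) \<subseteq> graev_ball S d g \<epsilon>"
    using graev_dist_triangle[OF g, of h] h by (force simp: graev_ball_def)
  then show "\<exists>\<delta>>0. graev_ball S d h \<delta> \<subseteq> graev_ball S d g \<epsilon>"
    using h by (intro exI[of _ "\<epsilon> - graev_dist S d g h"]) (simp add: graev_ball_def)
qed (auto simp: graev_ball_def)

lemma graev_dist_mult:
  assumes "g \<in> carrier (free_group S)" "h \<in> carrier (free_group S)" "g' \<in> carrier (free_group S)" "h' \<in> carrier (free_group S)"
  shows "graev_dist S d (g \<otimes>\<^bsub>free_group S\<^esub> h) (g' \<otimes>\<^bsub>free_group S\<^esub> h') \<le> graev_dist S d g g' + graev_dist S d h h'"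
proof -
  let ?u = "inv\<^bsub>free_group S\<^esub> g \<otimes>\<^bsub>free_group S\<^esub> g'" and ?h = "inv\<^bsub>free_group S\<^esub> h"
  have u: "?u \<in> carrier (free_group S)" "?h \<in> carrier (free_group S)" using assms by simp_all
  have "inv\<^bsub>free_group S\<^esub> (g \<otimes>\<^bsub>free_group S\<^esub> h) \<otimes>\<^bsub>free_group S\<^esub> (g' \<otimes>\<^bsub>free_group S\<^esub> h') = 
      (?h \<otimes>\<^bsub>free_group S\<^esub> ?u \<otimes>\<^bsub>free_group S\<^esub> inv\<^bsub>free_group S\<^esub> ?h) \<otimes>\<^bsub>free_group S\<^esub> (?h \<otimes>\<^bsub>free_group S\<^esub> h')"
    using assms by (simp add: F.inv_mult_group F.m_assoc) (simp add: F.m_assoc[symmetric] del: one_free_group)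
  then show ?thesis
    unfolding graev_dist_def
    using graev_norm_mult[of "?h \<otimes>\<^bsub>free_group S\<^esub> ?u \<otimes>\<^bsub>free_group S\<^esub> inv\<^bsub>free_group S\<^esub> ?h" "?h \<otimes>\<^bsub>free_group S\<^esub> h'"] 
      graev_norm_conj[OF u] assms by simp
qed

lemma paratopological_group_graev_topology_of: "paratopological_group (free_group S) (graev_topology_of S d)"
proof -
  let ?T = "graev_topology_of S d" and ?m = "\<lambda>(x, y). x \<otimes>\<^bsub>free_group S\<^esub> y"
  have "continuous_map (prod_topology ?T ?T) ?T ?m"
    unfolding continuous_map_alt
  proof (intro conjI strip)
    fix U assume U: "openin ?T U"
    have "\<exists>A B. openin ?T A \<and> openin ?T B \<and> g \<in> A \<and> h \<in> B \<and> A \<times> B \<subseteq> ?m -` U \<inter> topspace (prod_topology ?T ?T)"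
      if gh: "g \<in> carrier (free_group S)" "h \<in> carrier (free_group S)" "g \<otimes>\<^bsub>free_group S\<^esub> h \<in> U" for g h
    proof -
      obtain \<epsilon> where \<epsilon>: "\<epsilon> > 0" "graev_ball S d (g \<otimes>\<^bsub>free_group S\<^esub> h) \<epsilon> \<subseteq> U"
        using U gh unfolding openin_graev_topology_of by blast
      have "g' \<otimes>\<^bsub>free_group S\<^esub> h' \<in> U" if "g' \<in> graev_ball S d g (\<epsilon> / 2)" "h' \<in> graev_ball S d h (\<epsilon> / 2)" for g' h'
        using that graev_dist_mult[OF gh(1,2), of g' h'] by (intro subsetD[OF \<epsilon>(2)]) (auto simp: graev_ball_def)
      then show ?thesis
        using \<epsilon>(1) gh
        by (intro exI[of _ "graev_ball S d g (\<epsilon> / 2)"] exI[of _ "graev_ball S d h (\<epsilon> / 2)"] conjI)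
          (auto intro: openin_graev_ball graev_ball_centre simp: topspace_graev_topology_of, auto simp: graev_ball_def)
    qed
    then show "openin (prod_topology ?T ?T) (?m -` U \<inter> topspace (prod_topology ?T ?T))"
      unfolding openin_prod_topology_alt by (auto simp: topspace_graev_topology_of)
  qed (auto simp: topspace_graev_topology_of)
  then show ?thesis
    by (simp add: paratopological_group_def group_free_group topspace_graev_topology_of)
qed

end

lemma paratopological_group_translation:
  assumes G: "paratopological_group G T" and g: "g \<in> carrier G"
  shows "continuous_map T T (\<lambda>h. g \<otimes>\<^bsub>G\<^esub> h)"
proof -
  have "continuous_map T (prod_topology T T) (\<lambda>h. (g, h))"
    using g G by (intro continuous_map_pairedI) (auto simp: paratopological_group_def)
  from continuous_map_compose[OF this] G show ?thesis
    by (force simp: paratopological_group_def o_def)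
qed

theorem graev_topology_of_iff:
  assumes "quasi_pseudometric_on S d"
  shows "T = graev_topology_of S d \<longleftrightarrow>
    paratopological_group (free_group S) T \<and>
    (\<forall>\<epsilon>>0. openin T (graev_ball S d \<one>\<^bsub>free_group S\<^esub> \<epsilon>)) \<and>
    (\<forall>U. openin T U \<and> \<one>\<^bsub>free_group S\<^esub> \<in> U \<longrightarrow> (\<exists>\<epsilon>>0. graev_ball S d \<one>\<^bsub>free_group S\<^esub> \<epsilon> \<subseteq> U))"
    (is "_ \<longleftrightarrow> ?R T")
proof -
  interpret group "free_group S" by (rule group_free_group)
  have d: "\<And>x y. x \<in> S \<Longrightarrow> y \<in> S \<Longrightarrow> 0 \<le> d x y"
    using assms by (simp add: quasi_pseudometric_on_def)
  have R: "?R (graev_topology_of S d)"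
    using paratopological_group_graev_topology_of[of S d, OF d] openin_graev_ball[of S d, OF d one_closed]
    by (auto simp: openin_graev_topology_of simp del: one_free_group)
  have ball: "h \<in> graev_ball S d g \<epsilon> \<longleftrightarrow> h \<in> carrier (free_group S) \<and>
      inv\<^bsub>free_group S\<^esub> g \<otimes>\<^bsub>free_group S\<^esub> h \<in> graev_ball S d \<one>\<^bsub>free_group S\<^esub> \<epsilon>" if "g \<in> carrier (free_group S)" for g h \<epsilon>
    using that by (auto simp: graev_ball_def graev_dist_def simp del: one_free_group)
  have "openin T U \<longleftrightarrow> openin (graev_topology_of S d) U" if T: "?R T" for T U
  proof
    have pT: "paratopological_group (free_group S) T" and topT: "topspace T = carrier (free_group S)"
      using T by (auto simp: paratopological_group_def)
    assume U: "openin T U"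
    show "openin (graev_topology_of S d) U"
      unfolding openin_graev_topology_of
    proof (intro conjI ballI)
      show sub: "U \<subseteq> carrier (free_group S)" using openin_subset[OF U] topT by simp
      fix g assume g: "g \<in> U"
      then have gF: "g \<in> carrier (free_group S)" using sub by blast
      have "openin T ((\<lambda>h. g \<otimes>\<^bsub>free_group S\<^esub> h) -` U \<inter> topspace T)"
        using paratopological_group_translation[OF pT gF] U unfolding continuous_map_alt by blast
      moreover have "\<one>\<^bsub>free_group S\<^esub> \<in> (\<lambda>h. g \<otimes>\<^bsub>free_group S\<^esub> h) -` U \<inter> topspace T"
        using g gF topT by (simp del: one_free_group)
      ultimately obtain \<epsilon> where \<epsilon>: "\<epsilon> > 0" 
        "graev_ball S d \<one>\<^bsub>free_group S\<^esub> \<epsilon> \<subseteq> (\<lambda>h. g \<otimes>\<^bsub>free_group S\<^esub> h) -` U \<inter> topspace T"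
        using T by meson
      have "h \<in> U" if "h \<in> graev_ball S d g \<epsilon>" for h
      proof -
        have "h \<in> carrier (free_group S)" "g \<otimes>\<^bsub>free_group S\<^esub> (inv\<^bsub>free_group S\<^esub> g \<otimes>\<^bsub>free_group S\<^esub> h) \<in> U"
          using that \<epsilon>(2) by (auto simp: ball[OF gF])
        then show ?thesis using gF by (simp flip: m_assoc del: one_free_group)
      qed
      then show "\<exists>\<epsilon>>0. graev_ball S d g \<epsilon> \<subseteq> U" using \<epsilon>(1) by blast
    qed
  next
    have pT: "paratopological_group (free_group S) T" and topT: "topspace T = carrier (free_group S)"
      using T by (auto simp: paratopological_group_def)
    assume U: "openin (graev_topology_of S d) U"
    show "openin T U"
    proof (subst openin_subopen, intro ballI)
      fix g assume g: "g \<in> U"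
      then obtain \<epsilon> where \<epsilon>: "\<epsilon> > 0" "graev_ball S d g \<epsilon> \<subseteq> U" and gF: "g \<in> carrier (free_group S)"
        using U unfolding openin_graev_topology_of by blast
      have ball_eq: "graev_ball S d g \<epsilon> = 
          (\<lambda>h. inv\<^bsub>free_group S\<^esub> g \<otimes>\<^bsub>free_group S\<^esub> h) -` graev_ball S d \<one>\<^bsub>free_group S\<^esub> \<epsilon> \<inter> topspace T"
        using ball[OF gF] topT by blast
      have "openin T (graev_ball S d g \<epsilon>)"
        unfolding ball_eq using paratopological_group_translation[OF pT inv_closed[OF gF]] T \<epsilon>(1)
        unfolding continuous_map_alt by blast
      moreover have "g \<in> graev_ball S d g \<epsilon>" by (rule graev_ball_centre[OF d gF \<epsilon>(1)])
      ultimately show "\<exists>V. openin T V \<and> g \<in> V \<and> V \<subseteq> U" using \<epsilon>(2) by blast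
    qed
  qed
  then show ?thesis using R by (metis topology_eq)
qed

end

theory Submission
  imports Defs
begin

text \<open>In any paratopological group topology for which the inclusion of \<open>X\<close> is continuous, \<open>y \<in> cl {x}\<close>
  forces \<open>y\<inverse> x\<close> into every neighbourhood of \<open>e\<close>, so every neighbourhood of \<open>x\<inverse>\<close> contains \<open>(cl {x})\<inverse>\<close>. This
  applies to \<open>\<T>\<^sub>F\<close>, which is finer than \<open>\<T>\<^sub>G\<close>. Conversely, a closed set \<open>A\<close> with complement \<open>U\<close> gives the
  quasi-pseudometric \<open>max 0 (1\<^sub>U x - 1\<^sub>U y)\<close>. The homomorphism extending \<open>1\<^sub>U\<close> bounds
  the corresponding Graev norm from below, and this keeps \<open>U\<inverse>\<close> at distance at least \<open>1\<close> from \<open>A\<inverse>\<close>.\<close>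

section \<open>A real-valued homomorphism on the free group, as a lower bound for the Graev
  norm\<close>

definition word_sum :: "('a \<Rightarrow> real) \<Rightarrow> 'a word \<Rightarrow> real" where
  "word_sum f w = (\<Sum>a\<leftarrow>w. if snd a then f (fst a) else - f (fst a))"

lemma word_sum_simps [simp]:
  "word_sum f [] = 0"
  "word_sum f (a # w) = (if snd a then f (fst a) else - f (fst a)) + word_sum f w"
  "word_sum f (u @ v) = word_sum f u + word_sum f v"
  by (simp_all add: word_sum_def)

text \<open>A letter and its inverse contribute opposite values, so cancellation preserves the sum;
  hence \<open>word_sum f\<close> is a homomorphism into the additive reals.\<close>

lemma word_sum_cancel_cons: "word_sum f (cancel_cons a w) = word_sum f [a] + word_sum f w"
  by (cases w) (auto simp: flip_def)

lemma word_sum_reduce [simp]: "word_sum f (reduce w) = word_sum f w"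
  unfolding reduce_def by (induction w) (simp_all add: word_sum_cancel_cons)

lemma word_sum_mult: "word_sum f (u \<otimes>\<^bsub>free_group S\<^esub> v) = word_sum f u + word_sum f v"
  by (simp add: mult_free_group)

lemma word_sum_inv:
  assumes "u \<in> carrier (free_group S)"
  shows "word_sum f (inv\<^bsub>free_group S\<^esub> u) = - word_sum f u"
proof -
  have "inv\<^bsub>free_group S\<^esub> u \<otimes>\<^bsub>free_group S\<^esub> u = []"
    using group.l_inv[OF group_free_group assms] by simp
  then have "word_sum f (inv\<^bsub>free_group S\<^esub> u \<otimes>\<^bsub>free_group S\<^esub> u) = 0"
    by simp
  then show ?thesis
    by (simp add: word_sum_mult)
qed

lemma word_sum_represented: "word_sum f (represented S xs) = (\<Sum>x\<leftarrow>xs. word_sum f x)"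
  by (induction xs) (simp_all add: represented_def word_sum_mult)

context
  fixes S :: "'a set" and d :: "'a \<Rightarrow> 'a \<Rightarrow> real" and f :: "'a \<Rightarrow> real"
  assumes f_le_d: "\<And>x y. x \<in> S \<Longrightarrow> y \<in> S \<Longrightarrow> f x - f y \<le> d x y"
    and f_bounds: "\<And>x. x \<in> S \<Longrightarrow> 0 \<le> f x \<and> f x \<le> 1"
begin

lemma word_sum_le_dist_e:
  assumes "u \<in> gen ` S \<union> {\<one>\<^bsub>free_group S\<^esub>}" "v \<in> gen ` S \<union> {\<one>\<^bsub>free_group S\<^esub>}"
  shows "word_sum f u - word_sum f v \<le> dist_e S d u v"
proof -
  have "- 1 \<le> f x" "f x \<le> 1" if "x \<in> S" for x
    using f_bounds[OF that] by simp_all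
  then show ?thesis
    using assms f_le_d by (auto simp: dist_e_def the_inv_f_f[OF inj_gen]) (auto simp: gen_def)
qed

text \<open>Between two inverse letters, \<open>dist_star\<close> inverts and swaps its arguments,
  which leaves the difference of the sums unchanged. The default value 2 suffices because every
  letter has a sum in [-1, 1].\<close>

lemma word_sum_le_dist_star:
  assumes u: "u \<in> alphabet S" and v: "v \<in> alphabet S"
  shows "word_sum f u - word_sum f v \<le> dist_star S d u v"
proof -
  interpret group "free_group S" by (rule group_free_group)
  have bound: "\<bar>word_sum f w\<bar> \<le> 1" if "w \<in> alphabet S" for w
    using that f_bounds by (auto simp: alphabet_def inverses_eq gen_def)
  have inv: "inv\<^bsub>free_group S\<^esub> w \<in> gen ` S \<union> {\<one>\<^bsub>free_group S\<^esub>}"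
    if "w \<in> inverses S S \<union> {\<one>\<^bsub>free_group S\<^esub>}" for w
    using that by (auto simp: inverses_def gen_mem simp del: one_free_group)
  show ?thesis
    using word_sum_le_dist_e[of u v] bound[OF u] bound[OF v]
      word_sum_le_dist_e[OF inv[of v] inv[of u]]
      word_sum_inv[OF alphabet_mem[OF u], of f] word_sum_inv[OF alphabet_mem[OF v], of f]
    by (auto simp: dist_star_def Let_def simp del: one_free_group)
qed

text \<open>By the bound on letters, the term at \<open>i\<close> is at least minus the sums of the
  letters at \<open>i\<close> and \<open>\<phi> i\<close>. As \<open>\<phi>\<close> permutes the
  indices, each letter is counted twice, which the factor 1/2 in the cost undoes.\<close>

lemma word_sum_le_scheme_cost:
  assumes xs: "length xs = 2 * n" "set xs \<subseteq> alphabet S" and \<phi>: "scheme n \<phi>"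
  shows "- word_sum f (represented S xs) \<le> scheme_cost S d n xs \<phi>"
proof -
  let ?w = "\<lambda>i. word_sum f (xs ! (i - 1))"
  have mem: "xs ! (i - 1) \<in> alphabet S" if "i \<in> {1..2 * n}" for i
    using xs that by (intro subsetD[OF xs(2)] nth_mem) auto
  have "word_sum f (represented S xs) = (\<Sum>i<2 * n. word_sum f (xs ! i))"
    using xs(1) by (simp add: word_sum_represented sum_list_sum_nth atLeast0LessThan)
  \<comment> \<open>List positions start at 0, scheme indices at 1.\<close>
  also have "\<dots> = (\<Sum>i = 1..2 * n. ?w i)"
    by (rule sum.reindex_bij_witness[of _ "\<lambda>i. i - 1" Suc]) auto
  finally have total: "word_sum f (represented S xs) = (\<Sum>i = 1..2 * n. ?w i)" .
  have "bij_betw \<phi> {1..2 * n} {1..2 * n}"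
    using \<phi> by (simp add: scheme_def)
  then have "(\<Sum>i = 1..2 * n. ?w (\<phi> i)) = (\<Sum>i = 1..2 * n. ?w i)"
    by (rule sum.reindex_bij_betw)
  then have "- 2 * word_sum f (represented S xs) = (\<Sum>i = 1..2 * n. - ?w i - ?w (\<phi> i))"
    by (simp add: total sum_subtractf sum_negf)
  also have "\<dots> \<le> (\<Sum>i = 1..2 * n. dist_star S d (inv\<^bsub>free_group S\<^esub> (xs ! (i - 1))) (xs ! (\<phi> i - 1)))"
  proof (rule sum_mono)
    fix i assume i: "i \<in> {1..2 * n}"
    show "- ?w i - ?w (\<phi> i) \<le> dist_star S d (inv\<^bsub>free_group S\<^esub> (xs ! (i - 1))) (xs ! (\<phi> i - 1))"
      using word_sum_le_dist_star[OF alphabet_inv[OF mem[OF i]] mem[OF scheme_range[OF \<phi> i]]]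
        word_sum_inv[OF alphabet_mem[OF mem[OF i]], of f] by simp
  qed
  finally show ?thesis by (simp add: scheme_cost_def)
qed

lemma word_sum_le_graev_norm:
  assumes g: "g \<in> carrier (free_group S)"
  shows "- word_sum f g \<le> graev_norm S d g"
proof (cases "g = \<one>\<^bsub>free_group S\<^esub>")
  case False
  have "- word_sum f g \<le> Inf (graev_costs S d g)"
    by (rule cInf_greatest[OF graev_costs_nonempty[OF g False]])
      (use word_sum_le_scheme_cost in \<open>auto simp: graev_costs_def\<close>)
  then show ?thesis
    using False by (simp add: graev_norm_def graev_costs_def)
qed (simp add: graev_norm_def)

lemma word_sum_le_graev_dist:
  assumes "g \<in> carrier (free_group S)" "h \<in> carrier (free_group S)"
  shows "word_sum f g - word_sum f h \<le> graev_dist S d g h"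
proof -
  interpret group "free_group S" by (rule group_free_group)
  show ?thesis
    using word_sum_le_graev_norm[of "inv\<^bsub>free_group S\<^esub> g \<otimes>\<^bsub>free_group S\<^esub> h"] assms
    by (simp add: graev_dist_def word_sum_mult word_sum_inv)
qed

end

section \<open>The Graev topology is coarser than the free topology\<close>

lemma graev_dist_gen_le:
  assumes d: "\<And>x y. x \<in> S \<Longrightarrow> y \<in> S \<Longrightarrow> 0 \<le> d x y" and x: "x \<in> S" and y: "y \<in> S"
  shows "graev_dist S d (gen x) (gen y) \<le> d x y"
proof -
  interpret group "free_group S" by (rule group_free_group)
  \<comment> \<open>A word of two letters; \<open>?\<phi>\<close> swaps 1 and 2. The cost is the
    mean of the distances from \<open>x\<close> to \<open>y\<close> and from the inverse of
    \<open>y\<close> to that of \<open>x\<close>.\<close>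
  let ?xs = "[inv\<^bsub>free_group S\<^esub> gen x, gen y]" and ?\<phi> = "\<lambda>i. 3 - i :: nat"
  have "set ?xs \<subseteq> alphabet S"
    using x y by (auto simp: alphabet_def inverses_def)
  moreover have "represented S ?xs = inv\<^bsub>free_group S\<^esub> gen x \<otimes>\<^bsub>free_group S\<^esub> gen y"
    using x y by (simp add: represented_def gen_mem del: one_free_group)
  moreover have "scheme 1 ?\<phi>"
    by (rule schemeI) (auto, presburger)
  ultimately have "scheme_cost S d 1 ?xs ?\<phi> \<in> graev_costs S d (inv\<^bsub>free_group S\<^esub> gen x \<otimes>\<^bsub>free_group S\<^esub> gen y)"
    unfolding graev_costs_def mem_Collect_eq by (intro exI conjI; simp)
  then have "graev_dist S d (gen x) (gen y) \<le> scheme_cost S d 1 ?xs ?\<phi>"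
    unfolding graev_dist_def by (intro graev_norm_le) (rule d)
  also have "\<dots> \<le> d x y"
  proof -
    have 1: "dist_star S d (gen x) (gen y) \<le> d x y"
      using d x y by (auto simp: dist_star_def dist_e_def the_inv_f_f[OF inj_gen])
    have 2: "dist_star S d (inv\<^bsub>free_group S\<^esub> gen y) (inv\<^bsub>free_group S\<^esub> gen x) \<le> d x y"
    proof -
      \<comment> \<open>An inverse letter is neither a generator nor \<open>e\<close>, so for
        distinct \<open>x\<close> and \<open>y\<close> the clause for inverses applies and leads
        back to \<open>d x y\<close>.\<close>
      have "inv\<^bsub>free_group S\<^esub> gen z \<notin> gen ` S \<union> {\<one>\<^bsub>free_group S\<^esub>}" if "z \<in> S" for z
        unfolding inv_gen[OF that] by (auto simp: gen_def)
      moreover have "inv\<^bsub>free_group S\<^esub> gen z \<in> inverses S S" if "z \<in> S" for z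
        using that by (simp add: inverses_def)
      ultimately show ?thesis
        using d x y by (auto simp: dist_star_def dist_e_def the_inv_f_f[OF inj_gen] gen_mem)
    qed
    have "{1..2 :: nat} = {1, 2}" by auto
    then show ?thesis
      using 1 2 x y by (simp add: scheme_cost_def gen_mem)
  qed
  finally show ?thesis .
qed

text \<open>The preimage under \<open>gen\<close> of a Graev ball around \<open>gen x\<close>
  contains the \<open>d\<close>-ball around \<open>x\<close>, which is open by upper semicontinuity.
  So each of these topologies belongs to the family whose supremum is the free topology.\<close>

lemma admissible_graev_topology_of:
  assumes dX: "d \<in> graev_family X"
  shows "admissible X (graev_topology_of (topspace X) d)"
proof -
  let ?S = "topspace X"
  have d: "0 \<le> d x y" if "x \<in> ?S" "y \<in> ?S" for x y
    using dX that by (simp add: graev_family_def quasi_pseudometric_on_def)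
  have "openin X (gen -` W \<inter> ?S)" if W: "openin (graev_topology_of ?S d) W" for W
  proof (subst openin_subopen, intro ballI)
    fix x assume x: "x \<in> gen -` W \<inter> ?S"
    then obtain \<epsilon> where \<epsilon>: "\<epsilon> > 0" "graev_ball ?S d (gen x) \<epsilon> \<subseteq> W"
      using W by (auto simp: openin_graev_topology_of)
    let ?V = "{y \<in> ?S. d x y < \<epsilon>}"
    have "openin X ?V"
      using dX x by (simp add: graev_family_def upper_semicontinuous_def)
    moreover have "x \<in> ?V"
      using dX x \<epsilon>(1) by (simp add: graev_family_def quasi_pseudometric_on_def)
    moreover have "gen y \<in> W" if "y \<in> ?V" for y
      using that x graev_dist_gen_le[of ?S d x y, OF d]
      by (intro subsetD[OF \<epsilon>(2)]) (auto simp: graev_ball_def gen_mem)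
    ultimately show "\<exists>V. openin X V \<and> x \<in> V \<and> V \<subseteq> gen -` W \<inter> ?S"
      by (intro exI[of _ ?V]) auto
  qed
  then have "continuous_map X (graev_topology_of ?S d) gen"
    unfolding continuous_map_alt by (auto simp: topspace_graev_topology_of gen_mem)
  then show ?thesis
    using paratopological_group_graev_topology_of[of ?S d] d by (simp add: admissible_def)
qed

lemma openin_free_topology_if_graev:
  assumes "openin (graev_topology X) W"
  shows "openin (free_topology X) W"
proof -
  have "openin (free_topology X) V"
    if "V \<in> (\<Union>d\<in>graev_family X. {U. openin (graev_topology_of (topspace X) d) U})" for V
    using that by (auto simp: free_topology_eq intro: openin_sup_admissible[OF admissible_graev_topology_of])
  then show ?thesis
    using assms unfolding graev_topology_def openin_topology_generated_by_iff
    by (blast intro: generate_topology_on_coarsest[OF istopology_openin])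
qed

section \<open>Neighbourhoods of inverses in the free topology\<close>

text \<open>Inversion may be discontinuous, so \<open>y\<close> and \<open>x\<close> are exchanged
  for their inverses by a two-sided translation of \<open>X\<close> instead.\<close>

lemma inv_gen_mem_open_if_closure:
  assumes T: "admissible X T" and W: "openin T W"
    and x: "x \<in> topspace X" "inv\<^bsub>free_group (topspace X)\<^esub> gen x \<in> W"
    and y: "y \<in> X closure_of {x}"
  shows "inv\<^bsub>free_group (topspace X)\<^esub> gen y \<in> W"
proof -
  let ?F = "free_group (topspace X)"
  interpret group ?F by (rule group_free_group)
  have pT: "paratopological_group ?F T" and cont: "continuous_map X T gen"
    using T by (auto simp: admissible_def)
  have topT: "topspace T = carrier ?F"
    using pT by (simp add: paratopological_group_def)
  have yX: "y \<in> topspace X"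
    using y by (rule in_closure_of[THEN iffD1, THEN conjunct1])
  let ?x = "inv\<^bsub>?F\<^esub> gen x" and ?y = "inv\<^bsub>?F\<^esub> gen y"
  note mem = gen_mem[OF x(1)] gen_mem[OF yX]
  \<comment> \<open>The continuous map \<open>z \<mapsto> y\<inverse> z x\<inverse>\<close> on \<open>X\<close> sends \<open>y\<close> to \<open>x\<inverse>\<close> and \<open>x\<close> to \<open>y\<inverse>\<close>.\<close>
  let ?m = "\<lambda>z. (?y \<otimes>\<^bsub>?F\<^esub> gen z) \<otimes>\<^bsub>?F\<^esub> ?x"
  have "continuous_map X T (\<lambda>z. ?y \<otimes>\<^bsub>?F\<^esub> gen z)"
    using continuous_map_compose[OF cont paratopological_group_translation[OF pT, of ?y]] mem
    by (simp add: o_def)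
  then have "continuous_map X (prod_topology T T) (\<lambda>z. (?y \<otimes>\<^bsub>?F\<^esub> gen z, ?x))"
    using mem topT by (intro continuous_map_pairedI) auto
  from continuous_map_compose[OF this] pT have "continuous_map X T ?m"
    by (force simp: paratopological_group_def o_def)
  then have V: "openin X {z \<in> topspace X. ?m z \<in> W}" (is "openin X ?V")
    using W by (simp add: continuous_map_def)
  have "?m y = ?x"
    using mem by (simp del: one_free_group)
  then have "y \<in> ?V"
    using yX x(2) by simp
  \<comment> \<open>\<open>?V\<close> is an open neighbourhood of \<open>y\<close>, a point of the
    closure of \<open>{x}\<close>, so it meets \<open>{x}\<close>.\<close>
  with y V have "\<exists>z. z \<in> {x} \<and> z \<in> ?V"
    unfolding in_closure_of by meson
  then have "x \<in> ?V"
    by simp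
  moreover have "?m x = ?y"
    using mem by (simp add: m_assoc del: one_free_group)
  ultimately show ?thesis
    by simp
qed

lemma openin_subtopology_free_topology_imp:
  assumes "openin (subtopology (free_topology X) (inverses (topspace X) (topspace X))) B"
  shows "openin (inverse_topology X) B"
proof -
  let ?S = "topspace X"
  obtain W where W: "openin (free_topology X) W" "B = W \<inter> inverses ?S ?S"
    using assms by (auto simp: openin_subtopology)
  have adm: "admissible X (free_topology X)"
    by (simp add: free_topology_eq admissible_def paratopological_group_sup_admissible
        continuous_map_gen_sup_admissible)
  show ?thesis
  proof (subst openin_subopen, intro ballI)
    fix w assume "w \<in> B"
    then obtain x where x: "x \<in> ?S" "w = inv\<^bsub>free_group ?S\<^esub> gen x" "w \<in> W"
      using W(2) by (auto simp: inverses_def)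
    \<comment> \<open>The closure is the least closed set containing \<open>x\<close>, so
      \<open>?C\<close> is the least basic neighbourhood of \<open>w\<close> in
      \<open>inverse_topology X\<close>.\<close>
    let ?C = "inverses ?S (X closure_of {x})"
    have "openin (inverse_topology X) ?C"
      unfolding openin_inverse_topology by (rule arbitrary_union_of_inc) (use closedin_closure_of in blast)
    moreover have "w \<in> ?C"
      using x closure_of_subset[of "{x}" X] by (auto simp: inverses_def)
    moreover have "?C \<subseteq> B"
      using inv_gen_mem_open_if_closure[OF adm W(1) x(1)] x closure_of_subset_topspace[of X "{x}"]
      by (auto simp: W(2) inverses_def)
    ultimately show "\<exists>V. openin (inverse_topology X) V \<and> w \<in> V \<and> V \<subseteq> B"
      by blast
  qed
qed

section \<open>Inverses of closed sets are open in the Graev topology\<close>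

lemma openin_subtopology_graev_topology_inverses:
  assumes A: "closedin X A"
  shows "openin (subtopology (graev_topology X) (inverses (topspace X) (topspace X))) (inverses (topspace X) A)"
proof -
  let ?S = "topspace X" and ?f = "indicator (topspace X - A) :: 'a \<Rightarrow> real"
  let ?d = "\<lambda>x y. max 0 (?f x - ?f y)"
  have AS: "A \<subseteq> ?S" using A by (rule closedin_subset)
  have "openin X {y \<in> ?S. ?d x y < a}" if x: "x \<in> ?S" for x a
  proof -
    \<comment> \<open>\<open>?d x y\<close> is 1 if \<open>x\<close> lies outside \<open>A\<close>
      and \<open>y\<close> in \<open>A\<close>, and 0 otherwise; the ball is therefore empty, the
      open complement of \<open>A\<close>, or the whole space.\<close>
    have "{y \<in> ?S. ?d x y < a} =
        (if a \<le> 0 then {} else if a \<le> 1 \<and> x \<notin> A then ?S - A else ?S)"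
      using x by (auto simp: indicator_def)
    then show ?thesis using A by auto
  qed
  then have dX: "?d \<in> graev_family X"
    by (auto simp: graev_family_def quasi_pseudometric_on_def upper_semicontinuous_def indicator_def)
  let ?W = "\<Union>a\<in>A. graev_ball ?S ?d (inv\<^bsub>free_group ?S\<^esub> gen a) 1"
  interpret group "free_group ?S" by (rule group_free_group)
  have mem: "inv\<^bsub>free_group ?S\<^esub> gen z \<in> carrier (free_group ?S)" if "z \<in> ?S" for z
    using that by (simp add: gen_mem)
  have "openin (graev_topology_of ?S ?d) ?W"
    using AS by (intro openin_Union ballI) (auto intro!: openin_graev_ball mem)
  then have "openin (graev_topology X) ?W"
    unfolding graev_topology_def using dX by (intro topology_generated_by_Basis) blast
  moreover have "inverses ?S A = ?W \<inter> inverses ?S ?S"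
  proof (intro equalityI subsetI)
    fix w assume "w \<in> inverses ?S A"
    then obtain a where a: "a \<in> A" "w = inv\<^bsub>free_group ?S\<^esub> gen a"
      by (auto simp: inverses_def)
    then have "w \<in> graev_ball ?S ?d (inv\<^bsub>free_group ?S\<^esub> gen a) 1"
      using AS by (auto intro!: graev_ball_centre mem)
    then show "w \<in> ?W \<inter> inverses ?S ?S"
      using a AS by (auto simp: inverses_def)
  next
    fix w assume "w \<in> ?W \<inter> inverses ?S ?S"
    then obtain a y where a: "a \<in> A" "graev_dist ?S ?d (inv\<^bsub>free_group ?S\<^esub> gen a) w < 1"
      and y: "y \<in> ?S" "w = inv\<^bsub>free_group ?S\<^esub> gen y"
      by (auto simp: graev_ball_def inverses_def)
    \<comment> \<open>The left side equals \<open>?f y\<close>, so a distance below 1 forces the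
      indicator to vanish at \<open>y\<close>.\<close>
    have "word_sum ?f (inv\<^bsub>free_group ?S\<^esub> gen a) - word_sum ?f w
        \<le> graev_dist ?S ?d (inv\<^bsub>free_group ?S\<^esub> gen a) w"
      using a(1) AS y by (intro word_sum_le_graev_dist) (auto simp: indicator_def gen_mem)
    moreover have "word_sum ?f (inv\<^bsub>free_group ?S\<^esub> gen a) = 0" "word_sum ?f w = - ?f y"
      using a(1) AS y by (auto simp: inv_gen)
    ultimately have "?f y < 1" using a(2) by simp
    then have "y \<in> A" using y(1) by (auto simp: indicator_def split: if_splits)
    then show "w \<in> inverses ?S A" using y(2) by (auto simp: inverses_def)
  qed
  ultimately show ?thesis
    by (auto simp: openin_subtopology)
qed

theorem theorem4p2:
  fixes X :: "'a topology"
  shows "inverse_topology X =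
           subtopology (graev_topology X) (inverses (topspace X) (topspace X)) \<and>
         subtopology (graev_topology X) (inverses (topspace X) (topspace X)) =
           subtopology (free_topology X) (inverses (topspace X) (topspace X))"
proof -
  let ?I = "inverses (topspace X) (topspace X)"
  \<comment> \<open>The inclusions form a cycle: from \<open>inverse_topology X\<close> to the Graev
    trace, to the free trace, and back.\<close>
  have "openin (subtopology (graev_topology X) ?I) B" if B: "openin (inverse_topology X) B" for B
  proof -
    obtain \<U> where \<U>: "\<U> \<subseteq> {B. \<exists>A. closedin X A \<and> B = inverses (topspace X) A}" "\<Union>\<U> = B"
      using B unfolding openin_inverse_topology union_of_def by auto
    show ?thesis
      unfolding \<U>(2)[symmetric]
      using \<U>(1) openin_subtopology_graev_topology_inverses by (intro openin_Union) blast
  qed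
  moreover have "openin (subtopology (free_topology X) ?I) B"
    if "openin (subtopology (graev_topology X) ?I) B" for B
    using that openin_free_topology_if_graev by (auto simp: openin_subtopology)
  ultimately show ?thesis
    using openin_subtopology_free_topology_imp by (metis topology_eq)
qed

end
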